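(* Let $\mathcal H=\bigoplus_{n\ge0}\mathcal H_n$ be a graded connected Hopf algebra over $\mathbb R$ with each $\mathcal H_n$ finite-dimensional, let $P$ be a probability distribution on the weak-compositions of a fixed integer $n$, and let $\mathcal B=\bigsqcup_{m\ge0}\mathcal B_m$ be a state space basis of $\mathcal H$ for $P$. Then $$\hat K(x,y):=\frac{\eta(y)}{\eta(x)}\cdot\big(\text{coefficient of } y \text{ in } m\Delta_P(x)\big),\qquad x,y\in\mathcal B_n,$$ is a transition matrix (non-negative entries, rows summing to $1$). Moreover, one step of this Markov chain starting at $x\in\mathcal B_n$ has the same law as the following three-step process: (1) choose a weak-composition $D=(d_1,\dots,d_{l(D)})$ of $n$ with probability $P(D)$; (2) choose $(z_1,\dots,z_{l(D)})$ with $z_i\in\mathcal B_{d_i}$ with probability $\frac{1}{\eta(x)}\eta_x^{z_1,\dots,z_{l(D)}}\eta(z_1)\cdots\eta(z_{l(D)})$; (3) choose $y\in\mathcal B_n$ with probability $\big(\binom nD\eta(z_1)\cdots\eta(z_{l(D)})\big)^{-1}\xi^y_{z_1,\dots,z_{l(D)}}\eta(y)$. In particular, for each $D$ the numbers in (2) form a probability distribution, for each tuple chosen in (2) the numbers in (3) form a probability distribution, and the resulting probability of moving from $x$ to $y$ equals $\hat K(x,y)$.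
   Context: $\mathcal H_0=\mathbb R\cdot1$; $m$ is the multiplication (of any number of factors), $\Delta$ the coproduct, $\Delta^{[l]}=(\Delta\otimes\mathrm{id}^{\otimes(l-2)})\circ\cdots\circ(\Delta\otimes\mathrm{id})\circ\Delta:\mathcal H\to\mathcal H^{\otimes l}$. A weak-composition of $n$ is a tuple $D=(d_1,\dots,d_{l(D)})$ of non-negative integers summing to $n$; $\Delta_D$ is $\Delta^{[l(D)]}$ followed by projection to $\mathcal H_{d_1}\otimes\cdots\otimes\mathcal H_{d_{l(D)}}$; $m\Delta_D=m\circ\Delta_D:\mathcal H_n\to\mathcal H_n$; $m\Delta_P:=\sum_D\frac{P(D)}{\binom nD}m\Delta_D$ with $\binom nD=n!/(d_1!\cdots d_{l(D)}!)$. The basis $\mathcal B$ consists of homogeneous elements, $\mathcal B_m$ a basis of $\mathcal H_m$, with $\mathcal B_0=\{1\}$. Structure constants: for $z_i,x,y\in\mathcal B$, $z_1\cdots z_l=\sum_{y}\xi^y_{z_1,\dots,z_l}y$ and $\Delta^{[l]}(x)=\sum\eta_x^{z_1,\dots,z_l}z_1\otimes\cdots\otimes z_l$. The function $\eta:\mathcal H\to\mathbb R$ is linear with $\eta(x)$ = sum of the coefficients of $\Delta_{(1,\dots,1)}(x)$ in the basis $\{c_1\otimes\cdots\otimes c_{\deg x}: c_i\in\mathcal B_1\}$ (so $\eta(1)=1$). $\mathcal B$ is a state space basis for a weak-composition $D$ if (i) all $\xi^y_{z_1,\dots,z_{l(D)}}\ge0$ for $z_i\in\mathcal B_{d_i}$,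 $y\in\mathcal B_n$; (ii) for $x\in\mathcal B_n$, all coefficients of $\Delta_D(x)$ in the basis $\{z_1\otimes\cdots\otimes z_{l(D)}:z_i\in\mathcal B_{d_i}\}$ are $\ge0$; (iii) $\eta(x)>0$ for all $x\in\mathcal B$. It is a state space basis for $P$ if it is one for every $D$ with $P(D)>0$. *)

theory Defs
  imports
    "HOL-Analysis.Finite_Function_Topology"
    "HOL-Probability.Probability"
begin

section \<open>The tensor algebra of a real vector space\<close>

text \<open>
  All tensor powers of a vector space live in one type, the tensor algebra
  \<open>T(V) = \<Oplus>\<^sub>l V\<^sup>l\<close> (with \<open>V\<^sup>l\<close> the \<open>l\<close>-fold tensor power). It is the free vector space on words
  over \<open>V\<close>, modulo the relations making a word multilinear in its letters.
\<close>

definition multilinear_relations :: "('a::real_vector list \<Rightarrow>\<^sub>0 real) set" where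
  "multilinear_relations =
     {Poly_Mapping.single (xs @ (a + b) # ys) 1
        - Poly_Mapping.single (xs @ a # ys) 1 - Poly_Mapping.single (xs @ b # ys) 1 |xs ys a b. True}
   \<union> {Poly_Mapping.single (xs @ (c *\<^sub>R a) # ys) 1
        - c *\<^sub>R Poly_Mapping.single (xs @ a # ys) 1 |xs ys a c. True}"

definition tensor_rel :: "('a::real_vector list \<Rightarrow>\<^sub>0 real) \<Rightarrow> ('a list \<Rightarrow>\<^sub>0 real) \<Rightarrow> bool" where
  "tensor_rel p q \<longleftrightarrow> p - q \<in> span multilinear_relations"

lemma tensor_rel_equivp: "equivp tensor_rel"
proof (rule equivpI)
  show "reflp tensor_rel"
    by (simp add: reflp_def tensor_rel_def real_vector.span_zero)
  show "symp tensor_rel"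
    unfolding symp_def tensor_rel_def using real_vector.span_neg by fastforce
  show "transp tensor_rel"
    unfolding transp_def tensor_rel_def using real_vector.span_add by fastforce
qed

quotient_type (overloaded) 'a tensor = "'a::real_vector list \<Rightarrow>\<^sub>0 real" / tensor_rel
  by (rule tensor_rel_equivp)

instantiation tensor :: (real_vector) real_vector
begin

lift_definition zero_tensor :: "'a tensor" is 0 .

lift_definition plus_tensor :: "'a tensor \<Rightarrow> 'a tensor \<Rightarrow> 'a tensor" is "(+)"
  unfolding tensor_rel_def by (simp add: add_diff_add real_vector.span_add)

lift_definition uminus_tensor :: "'a tensor \<Rightarrow> 'a tensor" is uminus
  unfolding tensor_rel_def by (simp only: minus_diff_minus real_vector.span_neg)

lift_definition minus_tensor :: "'a tensor \<Rightarrow> 'a tensor \<Rightarrow> 'a tensor" is "(-)"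
proof -
  fix p q r s :: "'a list \<Rightarrow>\<^sub>0 real"
  assume "tensor_rel p q" "tensor_rel r s"
  then have "(p - q) - (r - s) \<in> span multilinear_relations"
    unfolding tensor_rel_def by (rule real_vector.span_diff)
  then show "tensor_rel (p - r) (q - s)"
    unfolding tensor_rel_def by (simp add: algebra_simps)
qed

lift_definition scaleR_tensor :: "real \<Rightarrow> 'a tensor \<Rightarrow> 'a tensor" is scaleR
  unfolding tensor_rel_def by (simp only: real_vector.span_scale flip: scaleR_diff_right)

instance
  by standard
    (transfer; simp add: tensor_rel_def algebra_simps real_vector.span_zero)+

end

lift_definition tens :: "'a::real_vector list \<Rightarrow> 'a tensor" is
  "\<lambda>xs. Poly_Mapping.single xs 1" .

abbreviation tens1 :: "'a::real_vector \<Rightarrow> 'a tensor" where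
  "tens1 x \<equiv> tens [x]"

definition tensor_power :: "nat \<Rightarrow> 'a::real_vector tensor set" where
  "tensor_power l = span {tens xs |xs. length xs = l}"

definition multilinear :: "('a::real_vector list \<Rightarrow> 'b::real_vector) \<Rightarrow> bool" where
  "multilinear f \<longleftrightarrow> (\<forall>xs ys. linear (\<lambda>a. f (xs @ a # ys)))"

text \<open>The linear map induced by a family of multilinear maps, one for each length.\<close>

definition tensor_lift :: "('a::real_vector list \<Rightarrow> 'b::real_vector) \<Rightarrow> 'a tensor \<Rightarrow> 'b" where
  "tensor_lift f = (THE g. linear g \<and> (\<forall>xs. g (tens xs) = f xs))"

lemma lookup_scaleR_poly_mapping:
  "Poly_Mapping.lookup (c *\<^sub>R p) k = c *\<^sub>R Poly_Mapping.lookup p k"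
proof -
  have "finite {i. c *\<^sub>R Poly_Mapping.lookup p i \<noteq> 0}"
    by (rule finite_subset[OF _ finite_lookup[of p]]) auto
  then show ?thesis
    unfolding scaleR_poly_mapping_def by simp
qed

lemma single_scaleR: "c *\<^sub>R Poly_Mapping.single xs (d::real) = Poly_Mapping.single xs (c * d)"
  by (rule poly_mapping_eqI) (simp add: lookup_scaleR_poly_mapping lookup_single when_def)

lemma poly_mapping_in_span: "p \<in> span (range (\<lambda>xs. Poly_Mapping.single xs (1::real)))"
proof -
  have "p = (\<Sum>xs\<in>Poly_Mapping.keys p. Poly_Mapping.lookup p xs *\<^sub>R Poly_Mapping.single xs 1)"
    by (rule poly_mapping_eqI)
      (simp add: lookup_sum single_scaleR lookup_single when_def in_keys_iff)
  then show ?thesis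
    by (metis (no_types, lifting) rangeI real_vector.span_base real_vector.span_scale real_vector.span_sum)
qed

lemma linear_abs_tensor: "linear abs_tensor"
  by (rule linearI) (simp_all add: plus_tensor.abs_eq scaleR_tensor.abs_eq)

lemma tensor_in_span: "t \<in> span (range tens)"
proof -
  have "abs_tensor p \<in> span (range tens)" for p :: "'a list \<Rightarrow>\<^sub>0 real"
  proof -
    have "abs_tensor p \<in> abs_tensor ` span (range (\<lambda>xs. Poly_Mapping.single xs (1::real)))"
      using poly_mapping_in_span by blast
    also have "\<dots> = span (abs_tensor ` range (\<lambda>xs. Poly_Mapping.single xs (1::real)))"
      by (simp add: linear_abs_tensor real_vector.linear_span_image)
    also have "abs_tensor ` range (\<lambda>xs. Poly_Mapping.single xs (1::real)) = range tens"
      by (auto simp: tens.abs_eq image_iff)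
    finally show ?thesis .
  qed
  then show ?thesis
    by (metis Quotient3_abs_rep Quotient3_tensor)
qed

lemma tensor_lift_exists:
  fixes f :: "'a::real_vector list \<Rightarrow> 'b::real_vector"
  assumes "multilinear f"
  shows "\<exists>g. linear g \<and> (\<forall>xs. g (tens xs) = f xs)"
proof -
  define F where "F p = (\<Sum>xs\<in>Poly_Mapping.keys p. Poly_Mapping.lookup p xs *\<^sub>R f xs)"
    for p :: "'a list \<Rightarrow>\<^sub>0 real"
  have F_sup: "F p = (\<Sum>xs\<in>A. Poly_Mapping.lookup p xs *\<^sub>R f xs)"
    if "finite A" "Poly_Mapping.keys p \<subseteq> A" for A p
    unfolding F_def using that by (intro sum.mono_neutral_left) (auto simp: in_keys_iff)
  have linF: "linear F"
  proof (rule linearI)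
    fix p q :: "'a list \<Rightarrow>\<^sub>0 real"
    let ?A = "Poly_Mapping.keys p \<union> Poly_Mapping.keys q"
    show "F (p + q) = F p + F q"
      using F_sup[of ?A "p + q"] F_sup[of ?A p] F_sup[of ?A q] keys_add[of p q]
      by (simp add: lookup_add scaleR_add_left sum.distrib)
  next
    fix c and p :: "'a list \<Rightarrow>\<^sub>0 real"
    have "Poly_Mapping.keys (c *\<^sub>R p) \<subseteq> Poly_Mapping.keys p"
      by (auto simp: in_keys_iff lookup_scaleR_poly_mapping)
    then show "F (c *\<^sub>R p) = c *\<^sub>R F p"
      using F_sup[of "Poly_Mapping.keys p" "c *\<^sub>R p"] F_sup[of "Poly_Mapping.keys p" p]
      by (simp add: lookup_scaleR_poly_mapping scaleR_sum_right)
  qed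
  have F_single: "F (Poly_Mapping.single xs 1) = f xs" for xs
    by (simp add: F_def)
  have lin: "linear (\<lambda>a. f (xs @ a # ys))" for xs ys
    using assms unfolding multilinear_def by blast
  have F0: "F r = 0" if "r \<in> span multilinear_relations" for r
  proof (rule linear_eq_0_on_span[OF linF _ that])
    fix r :: "'a list \<Rightarrow>\<^sub>0 real"
    assume "r \<in> multilinear_relations"
    moreover have "f (xs @ (a + b) # ys) = f (xs @ a # ys) + f (xs @ b # ys)"
      "f (xs @ (c *\<^sub>R a) # ys) = c *\<^sub>R f (xs @ a # ys)" for xs ys a b c
      by (rule linear_add[OF lin] linear_scale[OF lin])+
    ultimately show "F r = 0"
      unfolding multilinear_relations_def
      by (auto simp: linear_diff[OF linF] linear_scale[OF linF] F_single)
  qed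
  define g where "g t = F (rep_tensor t)" for t
  have g_abs: "g (abs_tensor p) = F p" for p
  proof -
    have "tensor_rel (rep_tensor (abs_tensor p)) p"
      by (metis Quotient3_rep_abs Quotient3_tensor equivp_reflp tensor_rel_equivp)
    then have "F (rep_tensor (abs_tensor p) - p) = 0"
      unfolding tensor_rel_def by (rule F0)
    then show ?thesis
      by (simp add: g_def linear_diff[OF linF])
  qed
  have abs_rep: "\<exists>p. t = abs_tensor p" for t :: "'a tensor"
    by (metis Quotient3_abs_rep Quotient3_tensor)
  have "linear g"
  proof (rule linearI)
    show "g (s + t) = g s + g t" for s t
    proof -
      obtain p q where "s = abs_tensor p" "t = abs_tensor q"
        using abs_rep by blast
      then show ?thesis
        by (simp add: plus_tensor.abs_eq g_abs linear_add[OF linF])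
    qed
    show "g (c *\<^sub>R t) = c *\<^sub>R g t" for c t
    proof -
      obtain p where "t = abs_tensor p"
        using abs_rep by blast
      then show ?thesis
        by (simp add: scaleR_tensor.abs_eq g_abs linear_scale[OF linF])
    qed
  qed
  moreover have "g (tens xs) = f xs" for xs
    by (simp add: tens.abs_eq g_abs F_single)
  ultimately show ?thesis
    by blast
qed

lemma
  assumes "multilinear f"
  shows linear_tensor_lift: "linear (tensor_lift f)"
    and tensor_lift_tens: "tensor_lift f (tens xs) = f xs"
proof -
  have "\<exists>!g. linear g \<and> (\<forall>xs. g (tens xs) = f xs)"
  proof (rule ex_ex1I[OF tensor_lift_exists[OF assms]])
    fix g h
    assume g: "linear g \<and> (\<forall>xs. g (tens xs) = f xs)" and h: "linear h \<and> (\<forall>xs. h (tens xs) = f xs)"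
    show "g = h"
    proof
      fix t
      show "g t = h t"
        by (rule linear_eq_on_span[of g h "range tens"]) (use g h tensor_in_span in auto)
    qed
  qed
  from theI'[OF this] show "linear (tensor_lift f)" "tensor_lift f (tens xs) = f xs"
    unfolding tensor_lift_def by auto
qed

definition tensor_conc :: "'a::real_vector tensor \<Rightarrow> 'a tensor \<Rightarrow> 'a tensor" where
  "tensor_conc s t = tensor_lift (\<lambda>xs. tensor_lift (\<lambda>ys. tens (xs @ ys)) t) s"

text \<open>
  \<open>tensor_maps [f\<^sub>1, \<dots>, f\<^sub>l]\<close> is \<open>f\<^sub>1 \<otimes> \<dots> \<otimes> f\<^sub>l\<close> on the \<open>l\<close>-th tensor power (and zero on the
  others). The factors take values in the tensor algebra, so a linear endomorphism \<open>f\<close> enters as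
  \<open>tens1 \<circ> f\<close>, the identity as \<open>tens1\<close>, and a functional \<open>f\<close> as \<open>\<lambda>x. f x *\<^sub>R tens []\<close>.
\<close>

definition tensor_maps :: "('a::real_vector \<Rightarrow> 'a tensor) list \<Rightarrow> 'a tensor \<Rightarrow> 'a tensor" where
  "tensor_maps fs = tensor_lift (\<lambda>xs.
     if length xs = length fs then foldr tensor_conc (map2 (\<lambda>f x. f x) fs xs) (tens []) else 0)"

definition tensor_times :: "'a::real_algebra_1 tensor \<Rightarrow> 'a tensor \<Rightarrow> 'a tensor" where
  "tensor_times s t = tensor_lift (\<lambda>xs. tensor_lift (\<lambda>ys.
     if length xs = length ys then tens (map2 (*) xs ys) else 0) t) s"

definition tensor_mult :: "'a::real_algebra_1 tensor \<Rightarrow> 'a" where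
  "tensor_mult = tensor_lift prod_list"

definition tensor_coeff :: "'a::real_vector list set \<Rightarrow> 'a tensor \<Rightarrow> 'a list \<Rightarrow> real" where
  "tensor_coeff W t zs = representation (tens ` W) t (tens zs)"

text \<open>The maps fed to \<^const>\<open>tensor_lift\<close> above are multilinear, so that it computes as intended.\<close>

lemma linear_tens: "linear (\<lambda>a. tens (xs @ a # ys))"
proof (rule linearI)
  fix a b :: 'a and c :: real
  let ?s = "\<lambda>a. Poly_Mapping.single (xs @ a # ys) (1::real)"
  have "?s (a + b) - ?s a - ?s b \<in> multilinear_relations"
    unfolding multilinear_relations_def by blast
  then have "?s (a + b) - (?s a + ?s b) \<in> span multilinear_relations"
    unfolding diff_diff_eq[symmetric] by (rule real_vector.span_base)
  then show "tens (xs @ (a + b) # ys) = tens (xs @ a # ys) + tens (xs @ b # ys)"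
    unfolding tens.abs_eq plus_tensor.abs_eq tensor.abs_eq_iff tensor_rel_def .
  have "?s (c *\<^sub>R a) - c *\<^sub>R ?s a \<in> multilinear_relations"
    unfolding multilinear_relations_def by blast
  then show "tens (xs @ (c *\<^sub>R a) # ys) = c *\<^sub>R tens (xs @ a # ys)"
    unfolding tens.abs_eq scaleR_tensor.abs_eq tensor.abs_eq_iff tensor_rel_def
    by (rule real_vector.span_base)
qed

lemma tensor_mult_tens: "tensor_mult (tens xs) = prod_list xs"
proof -
  have "multilinear (prod_list :: 'a list \<Rightarrow> 'a)"
    unfolding multilinear_def
    by (intro allI linearI) (simp_all add: distrib_left distrib_right)
  then show ?thesis
    unfolding tensor_mult_def by (rule tensor_lift_tens)
qed

lemma multilinear_append: "multilinear (\<lambda>ys. tens (xs @ ys))"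
  unfolding multilinear_def
proof (intro allI)
  show "linear (\<lambda>a. tens (xs @ us @ a # vs))" for us vs
    using linear_tens[of "xs @ us" vs] by simp
qed

lemma linear_via_lift:
  fixes f :: "'a::real_vector \<Rightarrow> 'b::real_vector list \<Rightarrow> 'c::real_vector"
  assumes "\<And>a. multilinear (f a)" and "\<And>ys. linear (\<lambda>a. f a ys)"
  shows "linear (\<lambda>a. tensor_lift (f a) t)"
proof (rule linearI)
  have lin: "linear (tensor_lift (f a))" for a
    by (rule linear_tensor_lift[OF assms(1)])
  have tl: "tensor_lift (f a) (tens xs) = f a xs" for a xs
    by (rule tensor_lift_tens[OF assms(1)])
  show "tensor_lift (f (a + b)) t = tensor_lift (f a) t + tensor_lift (f b) t" for a b
  proof (rule linear_eq_on_span[OF lin linear_compose_add[OF lin lin] _ tensor_in_span])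
    fix u :: "'b tensor" assume "u \<in> range tens"
    then obtain xs where u: "u = tens xs" by blast
    show "tensor_lift (f (a + b)) u = tensor_lift (f a) u + tensor_lift (f b) u"
      unfolding u tl by (rule linear_add[OF assms(2)])
  qed
  show "tensor_lift (f (c *\<^sub>R a)) t = c *\<^sub>R tensor_lift (f a) t" for c a
  proof (rule linear_eq_on_span[OF lin linear_compose_scale_right[OF lin] _ tensor_in_span])
    fix u :: "'b tensor" assume "u \<in> range tens"
    then obtain xs where u: "u = tens xs" by blast
    show "tensor_lift (f (c *\<^sub>R a)) u = c *\<^sub>R tensor_lift (f a) u"
      unfolding u tl by (rule linear_scale[OF assms(2)])
  qed
qed

lemma multilinear_conc: "multilinear (\<lambda>xs. tensor_lift (\<lambda>ys. tens (xs @ ys)) t)"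
  unfolding multilinear_def
proof (intro allI linear_via_lift multilinear_append)
  show "linear (\<lambda>a. tens ((us @ a # vs) @ ys))" for us vs ys :: "'a list"
    using linear_tens[of us "vs @ ys"] by simp
qed

lemma tensor_conc_tens: "tensor_conc (tens xs) (tens ys) = tens (xs @ ys)"
  unfolding tensor_conc_def tensor_lift_tens[OF multilinear_conc]
  by (rule tensor_lift_tens[OF multilinear_append])

lemma linear_tensor_conc_left: "linear (\<lambda>s. tensor_conc s t)"
  unfolding tensor_conc_def using linear_tensor_lift[OF multilinear_conc] .

lemma linear_tensor_conc_right: "linear (tensor_conc s)"
proof -
  have lin: "linear (tensor_lift (\<lambda>ys. tens (xs @ ys)))" for xs :: "'a list"
    using linear_tensor_lift[OF multilinear_append] .
  have eq: "tensor_conc (tens xs) t = tensor_lift (\<lambda>ys. tens (xs @ ys)) t" for xs :: "'a list" and t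
    unfolding tensor_conc_def by (rule tensor_lift_tens[OF multilinear_conc])
  show ?thesis
  proof (rule linearI)
    show "tensor_conc s (t + u) = tensor_conc s t + tensor_conc s u" for t u
      by (rule linear_eq_on_span[of _ "\<lambda>s. tensor_conc s t + tensor_conc s u" "range tens"])
        (auto simp: linear_tensor_conc_left tensor_in_span eq linear_add[OF lin]
          intro: linear_compose_add)
    show "tensor_conc s (c *\<^sub>R t) = c *\<^sub>R tensor_conc s t" for c t
      by (rule linear_eq_on_span[of _ "\<lambda>s. c *\<^sub>R tensor_conc s t" "range tens"])
        (auto simp: linear_tensor_conc_left tensor_in_span eq linear_scale[OF lin]
          intro: linear_compose_scale_right)
  qed
qed

lemma linear_foldr_conc:
  assumes "\<And>f. f \<in> set fs \<Longrightarrow> linear f" and "length (xs @ a # ys) = length fs"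
  shows "linear (\<lambda>a. foldr tensor_conc (map2 (\<lambda>f x. f x) fs (xs @ a # ys)) u)"
  using assms
proof (induction xs arbitrary: fs)
  case Nil
  then obtain g gs where fs: "fs = g # gs"
    by (cases fs) auto
  then have "linear g"
    using Nil by simp
  then show ?case
    using linear_compose[OF _ linear_tensor_conc_left] by (simp add: fs o_def)
next
  case (Cons x xs)
  then obtain g gs where fs: "fs = g # gs"
    by (cases fs) auto
  then have "linear (\<lambda>a. foldr tensor_conc (map2 (\<lambda>f x. f x) gs (xs @ a # ys)) u)"
    using Cons by simp
  from linear_compose[OF this linear_tensor_conc_right] show ?case
    by (simp add: fs o_def)
qed

lemma
  assumes "\<And>f. f \<in> set fs \<Longrightarrow> linear f"
  shows linear_tensor_maps: "linear (tensor_maps fs)"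
    and tensor_maps_tens: "tensor_maps fs (tens xs) =
      (if length xs = length fs then foldr tensor_conc (map2 (\<lambda>f x. f x) fs xs) (tens []) else 0)"
proof -
  have "linear (\<lambda>a. if length (xs @ a # ys) = length fs
      then foldr tensor_conc (map2 (\<lambda>f x. f x) fs (xs @ a # ys)) (tens []) else 0)" for xs ys
  proof (cases "length xs + Suc (length ys) = length fs")
    case True
    then show ?thesis
      using linear_foldr_conc[of fs xs undefined ys, OF assms] by simp
  next
    case False
    then show ?thesis
      by (simp add: linear_zero)
  qed
  then have ml: "multilinear (\<lambda>xs. if length xs = length fs
      then foldr tensor_conc (map2 (\<lambda>f x. f x) fs xs) (tens []) else 0)"
    unfolding multilinear_def by blast
  show "linear (tensor_maps fs)"
    unfolding tensor_maps_def by (rule linear_tensor_lift[OF ml])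
  show "tensor_maps fs (tens xs) =
      (if length xs = length fs then foldr tensor_conc (map2 (\<lambda>f x. f x) fs xs) (tens []) else 0)"
    unfolding tensor_maps_def by (rule tensor_lift_tens[OF ml])
qed

lemma linear_tens_map2:
  fixes xs ys zs :: "'a::real_algebra_1 list"
  shows "linear (\<lambda>a. if length zs = length (xs @ a # ys) then tens (map2 (*) zs (xs @ a # ys)) else 0)"
    and "linear (\<lambda>a. if length (xs @ a # ys) = length zs then tens (map2 (*) (xs @ a # ys) zs) else 0)"
proof -
  have cs: thesis if "length zs \<noteq> length xs + Suc (length ys) \<Longrightarrow> thesis"
    "\<And>us c vs. zs = us @ c # vs \<Longrightarrow> length us = length xs \<Longrightarrow> length vs = length ys \<Longrightarrow> thesis" for thesis
  proof (cases "length zs = length xs + Suc (length ys)")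
    case True
    show ?thesis
    proof (rule that(2))
      show "zs = take (length xs) zs @ zs ! length xs # drop (Suc (length xs)) zs"
        using True by (simp add: id_take_nth_drop)
    qed (use True in auto)
  qed (rule that(1))
  have l: "linear (\<lambda>a. tens (us @ (c * a) # vs))" "linear (\<lambda>a. tens (us @ (a * c) # vs))"
    for us vs and c :: 'a
    using linear_compose[OF _ linear_tens[of us vs], of "(*) c"]
      linear_compose[OF _ linear_tens[of us vs], of "\<lambda>a. a * c"]
    by (auto simp: o_def linear_iff algebra_simps)
  show "linear (\<lambda>a. if length zs = length (xs @ a # ys) then tens (map2 (*) zs (xs @ a # ys)) else 0)"
    by (rule cs) (auto simp: linear_zero l)
  show "linear (\<lambda>a. if length (xs @ a # ys) = length zs then tens (map2 (*) (xs @ a # ys) zs) else 0)"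
    by (rule cs) (auto simp: linear_zero l)
qed

lemma tensor_times_tens:
  assumes "length xs = length ys"
  shows "tensor_times (tens xs) (tens ys) = tens (map2 (*) xs ys)"
proof -
  have 1: "multilinear (\<lambda>ys. if length xs = length ys then tens (map2 (*) xs ys) else 0)" for xs :: "'a list"
    unfolding multilinear_def using linear_tens_map2(1) by blast
  have 2: "multilinear (\<lambda>xs. tensor_lift (\<lambda>ys.
     if length xs = length ys then tens (map2 (*) xs ys) else 0) t)" for t :: "'a tensor"
    unfolding multilinear_def by (intro allI linear_via_lift 1 linear_tens_map2(2))
  show ?thesis
    using tensor_lift_tens[OF 2, of "tens ys" xs] tensor_lift_tens[OF 1, of xs ys] assms
    by (simp only: tensor_times_def if_True refl)
qed


section \<open>Graded connected Hopf algebras\<close>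

definition graded_decomposition :: "(nat \<Rightarrow> 'a::real_vector set) \<Rightarrow> 'a \<Rightarrow> (nat \<Rightarrow> 'a) \<Rightarrow> bool" where
  "graded_decomposition H x f \<longleftrightarrow>
     (\<forall>i. f i \<in> H i) \<and> finite {i. f i \<noteq> 0} \<and> x = (\<Sum>i | f i \<noteq> 0. f i)"

definition graded_component :: "(nat \<Rightarrow> 'a::real_vector set) \<Rightarrow> nat \<Rightarrow> 'a \<Rightarrow> 'a" where
  "graded_component H i x = (THE f. graded_decomposition H x f) i"

text \<open>The algebra structure (unit, associative product) is that of the type \<^typ>\<open>'a\<close>.\<close>

locale graded_connected_hopf_algebra =
  fixes H :: "nat \<Rightarrow> 'a::real_algebra_1 set"
    and \<Delta> :: "'a \<Rightarrow> 'a tensor"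
    and \<epsilon> :: "'a \<Rightarrow> real"
    and S :: "'a \<Rightarrow> 'a"
  assumes subspace_grade: "subspace (H i)"
    and direct_sum: "\<exists>!f. graded_decomposition H x f"
    and connected: "H 0 = span {1}"
    and mult_graded: "a \<in> H i \<Longrightarrow> b \<in> H j \<Longrightarrow> a * b \<in> H (i + j)"
    and linear_coproduct: "linear \<Delta>"
    and coproduct_range: "\<Delta> x \<in> tensor_power 2"
    and coproduct_graded:
      "x \<in> H n \<Longrightarrow> \<Delta> x \<in> span {tens [a, b] |a b i j. a \<in> H i \<and> b \<in> H j \<and> i + j = n}"
    and coassociative: "tensor_maps [\<Delta>, tens1] (\<Delta> x) = tensor_maps [tens1, \<Delta>] (\<Delta> x)"
    and linear_counit: "linear \<epsilon>"
    and counit_graded: "x \<in> H n \<Longrightarrow> n > 0 \<Longrightarrow> \<epsilon> x = 0"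
    and counit_left: "tensor_maps [\<lambda>a. \<epsilon> a *\<^sub>R tens [], tens1] (\<Delta> x) = tens1 x"
    and counit_right: "tensor_maps [tens1, \<lambda>a. \<epsilon> a *\<^sub>R tens []] (\<Delta> x) = tens1 x"
    and coproduct_mult: "\<Delta> (x * y) = tensor_times (\<Delta> x) (\<Delta> y)"
    and coproduct_one: "\<Delta> 1 = tens [1, 1]"
    and counit_mult: "\<epsilon> (x * y) = \<epsilon> x * \<epsilon> y"
    and counit_one: "\<epsilon> 1 = 1"
    and linear_antipode: "linear S"
    and antipode_graded: "x \<in> H n \<Longrightarrow> S x \<in> H n"
    and antipode_left: "tensor_mult (tensor_maps [tens1 \<circ> S, tens1] (\<Delta> x)) = \<epsilon> x *\<^sub>R 1"
    and antipode_right: "tensor_mult (tensor_maps [tens1, tens1 \<circ> S] (\<Delta> x)) = \<epsilon> x *\<^sub>R 1"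

text \<open>
  The 0-fold coproduct is the counit. It is only relevant in degree 0, for the empty
  weak-composition and for the normalisation \<open>\<eta>(1) = 1\<close>.
\<close>

fun iterated_coproduct ::
  "('a::real_algebra_1 \<Rightarrow> 'a tensor) \<Rightarrow> ('a \<Rightarrow> real) \<Rightarrow> nat \<Rightarrow> 'a \<Rightarrow> 'a tensor" where
  "iterated_coproduct \<Delta> \<epsilon> 0 x = \<epsilon> x *\<^sub>R tens []"
| "iterated_coproduct \<Delta> \<epsilon> (Suc 0) x = tens1 x"
| "iterated_coproduct \<Delta> \<epsilon> (Suc (Suc l)) x =
     tensor_maps (\<Delta> # replicate l tens1) (iterated_coproduct \<Delta> \<epsilon> (Suc l) x)"

definition coproduct_comp ::
  "(nat \<Rightarrow> 'a::real_algebra_1 set) \<Rightarrow> ('a \<Rightarrow> 'a tensor) \<Rightarrow> ('a \<Rightarrow> real) \<Rightarrow> nat list \<Rightarrow> 'a \<Rightarrow> 'a tensor"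
where
  "coproduct_comp H \<Delta> \<epsilon> D x =
     tensor_maps (map (\<lambda>d. tens1 \<circ> graded_component H d) D) (iterated_coproduct \<Delta> \<epsilon> (length D) x)"

definition weak_compositions :: "nat \<Rightarrow> nat list set" where
  "weak_compositions n = {D. sum_list D = n}"

definition multinomial :: "nat list \<Rightarrow> real" where
  "multinomial D = fact (sum_list D) / prod_list (map fact D)"

text \<open>
  There are infinitely many weak-compositions of \<open>n\<close>, so \<open>m\<Delta>\<^sub>P(x) = \<Sum>\<^sub>D P(D) / (n choose D) m\<Delta>\<^sub>D(x)\<close>
  is in general an infinite series. For \<open>x\<close> of degree \<open>n\<close> its terms lie in the finite-dimensional
  space \<open>H n\<close>, where convergence is convergence under every linear functional.
\<close>

definition descent_operator ::
  "(nat \<Rightarrow> 'a::real_algebra_1 set) \<Rightarrow> ('a \<Rightarrow> 'a tensor) \<Rightarrow> ('a \<Rightarrow> real) \<Rightarrow> nat \<Rightarrow> nat list pmf \<Rightarrow> 'a \<Rightarrow> 'a"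
where
  "descent_operator H \<Delta> \<epsilon> n P x = (THE v. \<forall>\<phi> :: 'a \<Rightarrow> real. linear \<phi> \<longrightarrow>
     ((\<lambda>D. pmf P D / multinomial D * \<phi> (tensor_mult (coproduct_comp H \<Delta> \<epsilon> D x))) has_sum \<phi> v)
       (weak_compositions n))"


section \<open>State space bases and the associated Markov chain\<close>

definition graded_basis :: "(nat \<Rightarrow> 'a::real_algebra_1 set) \<Rightarrow> (nat \<Rightarrow> 'a set) \<Rightarrow> bool" where
  "graded_basis H B \<longleftrightarrow> (\<forall>m. independent (B m) \<and> span (B m) = H m) \<and> B 0 = {1}"

definition mult_coeff :: "(nat \<Rightarrow> 'a::real_algebra_1 set) \<Rightarrow> 'a list \<Rightarrow> 'a \<Rightarrow> real" where
  "mult_coeff B zs y = representation (\<Union>m. B m) (prod_list zs) y"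

definition coproduct_coeff ::
  "('a::real_algebra_1 \<Rightarrow> 'a tensor) \<Rightarrow> ('a \<Rightarrow> real) \<Rightarrow> (nat \<Rightarrow> 'a set) \<Rightarrow> 'a \<Rightarrow> 'a list \<Rightarrow> real" where
  "coproduct_coeff \<Delta> \<epsilon> B x zs =
     tensor_coeff {ws. length ws = length zs \<and> set ws \<subseteq> (\<Union>m. B m)}
       (iterated_coproduct \<Delta> \<epsilon> (length zs) x) zs"

definition eta_homogeneous ::
  "(nat \<Rightarrow> 'a::real_algebra_1 set) \<Rightarrow> ('a \<Rightarrow> 'a tensor) \<Rightarrow> ('a \<Rightarrow> real) \<Rightarrow> (nat \<Rightarrow> 'a set) \<Rightarrow> nat \<Rightarrow> 'a \<Rightarrow> real"
where
  "eta_homogeneous H \<Delta> \<epsilon> B k x = (\<Sum>cs\<in>listset (replicate k (B 1)).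
     tensor_coeff (listset (replicate k (B 1))) (coproduct_comp H \<Delta> \<epsilon> (replicate k 1) x) cs)"

definition eta ::
  "(nat \<Rightarrow> 'a::real_algebra_1 set) \<Rightarrow> ('a \<Rightarrow> 'a tensor) \<Rightarrow> ('a \<Rightarrow> real) \<Rightarrow> (nat \<Rightarrow> 'a set) \<Rightarrow> 'a \<Rightarrow> real"
where
  "eta H \<Delta> \<epsilon> B x =
     (\<Sum>k | graded_component H k x \<noteq> 0. eta_homogeneous H \<Delta> \<epsilon> B k (graded_component H k x))"

definition state_space_basis_comp ::
  "(nat \<Rightarrow> 'a::real_algebra_1 set) \<Rightarrow> ('a \<Rightarrow> 'a tensor) \<Rightarrow> ('a \<Rightarrow> real) \<Rightarrow> (nat \<Rightarrow> 'a set) \<Rightarrow> nat list \<Rightarrow> bool"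
where
  "state_space_basis_comp H \<Delta> \<epsilon> B D \<longleftrightarrow>
     (\<forall>zs\<in>listset (map B D). \<forall>y\<in>B (sum_list D). mult_coeff B zs y \<ge> 0) \<and>
     (\<forall>x\<in>B (sum_list D). \<forall>zs\<in>listset (map B D).
        tensor_coeff (listset (map B D)) (coproduct_comp H \<Delta> \<epsilon> D x) zs \<ge> 0) \<and>
     (\<forall>x\<in>(\<Union>m. B m). eta H \<Delta> \<epsilon> B x > 0)"

definition state_space_basis ::
  "(nat \<Rightarrow> 'a::real_algebra_1 set) \<Rightarrow> ('a \<Rightarrow> 'a tensor) \<Rightarrow> ('a \<Rightarrow> real) \<Rightarrow> (nat \<Rightarrow> 'a set) \<Rightarrow> nat list pmf \<Rightarrow> bool"
where
  "state_space_basis H \<Delta> \<epsilon> B P \<longleftrightarrow>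
     graded_basis H B \<and> (\<forall>D. pmf P D > 0 \<longrightarrow> state_space_basis_comp H \<Delta> \<epsilon> B D)"

definition K_hat ::
  "(nat \<Rightarrow> 'a::real_algebra_1 set) \<Rightarrow> ('a \<Rightarrow> 'a tensor) \<Rightarrow> ('a \<Rightarrow> real) \<Rightarrow> (nat \<Rightarrow> 'a set) \<Rightarrow> nat \<Rightarrow> nat list pmf
    \<Rightarrow> 'a \<Rightarrow> 'a \<Rightarrow> real"
where
  "K_hat H \<Delta> \<epsilon> B n P x y =
     eta H \<Delta> \<epsilon> B y / eta H \<Delta> \<epsilon> B x * representation (\<Union>m. B m) (descent_operator H \<Delta> \<epsilon> n P x) y"

definition break_prob ::
  "(nat \<Rightarrow> 'a::real_algebra_1 set) \<Rightarrow> ('a \<Rightarrow> 'a tensor) \<Rightarrow> ('a \<Rightarrow> real) \<Rightarrow> (nat \<Rightarrow> 'a set) \<Rightarrow> 'a \<Rightarrow> 'a list \<Rightarrow> real"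
where
  "break_prob H \<Delta> \<epsilon> B x zs =
     1 / eta H \<Delta> \<epsilon> B x * coproduct_coeff \<Delta> \<epsilon> B x zs * prod_list (map (eta H \<Delta> \<epsilon> B) zs)"

definition join_prob ::
  "(nat \<Rightarrow> 'a::real_algebra_1 set) \<Rightarrow> ('a \<Rightarrow> 'a tensor) \<Rightarrow> ('a \<Rightarrow> real) \<Rightarrow> (nat \<Rightarrow> 'a set) \<Rightarrow> nat list
    \<Rightarrow> 'a list \<Rightarrow> 'a \<Rightarrow> real"
where
  "join_prob H \<Delta> \<epsilon> B D zs y =
     inverse (multinomial D * prod_list (map (eta H \<Delta> \<epsilon> B) zs)) * mult_coeff B zs y * eta H \<Delta> \<epsilon> B y"

text \<open>
  \<^const>\<open>embed_pmf\<close> is only meaningful on functions that are non-negative with total mass 1.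
\<close>

definition three_step_law ::
  "(nat \<Rightarrow> 'a::real_algebra_1 set) \<Rightarrow> ('a \<Rightarrow> 'a tensor) \<Rightarrow> ('a \<Rightarrow> real) \<Rightarrow> (nat \<Rightarrow> 'a set) \<Rightarrow> nat \<Rightarrow> nat list pmf
    \<Rightarrow> 'a \<Rightarrow> 'a pmf"
where
  "three_step_law H \<Delta> \<epsilon> B n P x =
     bind_pmf P (\<lambda>D.
     bind_pmf (embed_pmf (\<lambda>zs. if zs \<in> listset (map B D) then break_prob H \<Delta> \<epsilon> B x zs else 0)) (\<lambda>zs.
     embed_pmf (\<lambda>y. if y \<in> B n then join_prob H \<Delta> \<epsilon> B D zs y else 0)))"

definition prob_weights :: "'b set \<Rightarrow> ('b \<Rightarrow> real) \<Rightarrow> bool" where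
  "prob_weights A w \<longleftrightarrow> (\<forall>a\<in>A. w a \<ge> 0) \<and> (w has_sum 1) A"

end

theory Submission
  imports Defs
begin

text \<open>
  Let \<open>\<lambda>\<close> be the functional that sums the \<open>\<B>\<^sub>1\<close>-coordinates of the degree one component. On
  \<open>H\<^sub>k\<close> the function \<open>\<eta>\<close> is the \<open>k\<close>-th convolution power \<open>\<lambda>\<^sup>k\<close>, and this power vanishes in all
  other degrees. Evaluating \<open>\<lambda>\<^sup>i \<star> \<lambda>\<^sup>j = \<lambda>\<^sup>i\<^sup>+\<^sup>j\<close> on a basis element gives
  \<open>\<Sum> \<eta>\<^sub>x(z\<^sub>1, \<dots>, z\<^sub>l) \<eta>(z\<^sub>1) \<dots> \<eta>(z\<^sub>l) = \<eta>(x)\<close>, so the breaking probabilities sum to one. By connectedness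
  \<open>\<lambda>\<close> is an \<open>\<epsilon>\<close>-derivation, hence its powers satisfy the Leibniz rule
  \<open>\<lambda>\<^sup>k(ab) = \<Sum>\<^sub>j (k choose j) \<lambda>\<^sup>j(a) \<lambda>\<^sup>k\<^sup>-\<^sup>j(b)\<close>; in degree \<open>n\<close> only one term survives and \<open>\<eta>\<close> is
  multiplicative up to a multinomial coefficient, so the joining probabilities sum to one.
  The law of the three-step process then provides the convergence of the series for \<open>m\<Delta>\<^sub>P(x)\<close>.
\<close>

section \<open>Dual families and functionals on the tensor algebra\<close>

text \<open>Applying \<open>\<delta> i\<close> to a linear relation isolates the coefficient of
  \<open>b i\<close>. Such a family turns \<open>representation\<close> coefficients into values of
  linear functionals defined on the whole space. It serves first for the graded basis and then for
  tensor words, whose independence thus needs no separate argument.\<close>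

lemma
  fixes b :: "'i \<Rightarrow> 'v::real_vector" and \<delta> :: "'i \<Rightarrow> 'v \<Rightarrow> real"
    and F :: "'v \<Rightarrow> 'w::real_vector"
  assumes lin: "\<And>i. i \<in> W \<Longrightarrow> linear (\<delta> i)"
    and dual: "\<And>i j. i \<in> W \<Longrightarrow> j \<in> W \<Longrightarrow> \<delta> i (b j) = of_bool (i = j)"
  shows dual_family_independent: "independent (b ` W)"
    and dual_family_representation:
      "t \<in> span (b ` W) \<Longrightarrow> i \<in> W \<Longrightarrow> representation (b ` W) t (b i) = \<delta> i t"
    and dual_family_expand:
      "finite W \<Longrightarrow> linear F \<Longrightarrow> t \<in> span (b ` W) \<Longrightarrow> F t = (\<Sum>i\<in>W. \<delta> i t *\<^sub>R F (b i))"
proof -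
  have inj: "inj_on b W"
    by (rule inj_onI) (metis dual of_bool_eq_1_iff)
  show ind: "independent (b ` W)"
  proof
    assume "dependent (b ` W)"
    then obtain U u v where U: "finite U" "U \<subseteq> b ` W" "(\<Sum>v\<in>U. u v *\<^sub>R v) = 0" "v \<in> U" "u v \<noteq> 0"
      unfolding real_vector.dependent_explicit by blast
    then obtain i where i: "i \<in> W" "v = b i" by blast
    have "0 = \<delta> i (\<Sum>v\<in>U. u v *\<^sub>R v)"
      using U(3) linear_0[OF lin[OF i(1)]] by simp
    also have "\<dots> = (\<Sum>w\<in>U. u w * \<delta> i w)"
      by (simp add: linear_sum[OF lin[OF i(1)]] linear_scale[OF lin[OF i(1)]])
    also have "\<dots> = (\<Sum>w\<in>U. if w = v then u w else 0)"
      using U(2) i by (intro sum.cong) (auto simp: dual)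
    also have "\<dots> = u v"
      using U(1,4) by simp
    finally show False using U(5) by simp
  qed
  show "representation (b ` W) t (b i) = \<delta> i t" if t: "t \<in> span (b ` W)" and i: "i \<in> W"
  proof -
    from t have "t \<in> span (b ` W) \<and> representation (b ` W) t (b i) = \<delta> i t"
    proof (induction rule: real_vector.span_induct_alt)
      case base
      then show ?case
        by (simp add: real_vector.representation_zero linear_0[OF lin[OF i]] real_vector.span_zero)
    next
      case (step c x y)
      then obtain j where j: "j \<in> W" "x = b j" by blast
      have xs: "x \<in> span (b ` W)" using step(1) by (rule real_vector.span_base)
      have "representation (b ` W) x (b i) = of_bool (i = j)"
        using real_vector.representation_basis[OF ind step(1)] inj i j by (auto simp: inj_on_eq_iff)
      then show ?case
        using step xs i j
        by (simp add: real_vector.representation_add[OF ind] real_vector.span_scale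
            real_vector.span_add real_vector.representation_scale[OF ind] linear_add[OF lin[OF i]]
            linear_scale[OF lin[OF i]] dual)
    qed
    then show ?thesis ..
  qed
  show "F t = (\<Sum>i\<in>W. \<delta> i t *\<^sub>R F (b i))" if fin: "finite W" and F: "linear F" and t: "t \<in> span (b ` W)"
    using t
  proof (induction rule: real_vector.span_induct_alt)
    case base
    then show ?case by (simp add: linear_0[OF F] linear_0[OF lin])
  next
    case (step c x y)
    then obtain j where j: "j \<in> W" "x = b j" by blast
    have "(\<Sum>i\<in>W. \<delta> i x *\<^sub>R F (b i)) = (\<Sum>i\<in>W. if i = j then F (b i) else 0)"
      using j by (intro sum.cong) (auto simp: dual)
    also have "\<dots> = F x"
      using j fin by simp
    finally have "F x = (\<Sum>i\<in>W. \<delta> i x *\<^sub>R F (b i))" ..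
    then show ?case
      using step
      by (simp add: linear_add[OF F] linear_scale[OF F] linear_add[OF lin] linear_scale[OF lin]
          scaleR_sum_right sum.distrib scaleR_add_left)
  qed
qed

section \<open>Evaluation of tensors by tuples of functionals\<close>

text \<open>The tensor product of the functionals followed by multiplication of reals, the scalar
  counterpart of \<open>tensor_maps\<close>. Words of other lengths get 0 because
  \<open>tensor_lift\<close> needs a value on every word.\<close>

definition tensor_functional :: "('a::real_vector \<Rightarrow> real) list \<Rightarrow> 'a tensor \<Rightarrow> real" where
  "tensor_functional fs = tensor_lift (\<lambda>xs.
     if length xs = length fs then prod_list (map2 (\<lambda>f x. f x) fs xs) else 0)"

lemma linear_prod_list_map2:
  assumes "list_all linear fs" and "length (xs @ a # ys) = length fs"
  shows "linear (\<lambda>a. prod_list (map2 (\<lambda>f x. f x) fs (xs @ a # ys)) :: real)"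
  using assms
proof (induction xs arbitrary: fs)
  case Nil
  then obtain g gs where fs: "fs = g # gs" "linear g"
    by (cases fs) auto
  then show ?case
    by (simp add: linear_iff algebra_simps)
next
  case (Cons x xs)
  then obtain g gs where fs: "fs = g # gs"
    by (cases fs) auto
  then have "linear (\<lambda>a. prod_list (map2 (\<lambda>f x. f x) gs (xs @ a # ys)))"
    using Cons by simp
  then show ?case
    by (simp add: fs linear_iff algebra_simps)
qed

lemma
  assumes "list_all linear fs"
  shows linear_tensor_functional: "linear (tensor_functional fs)"
    and tensor_functional_tens: "tensor_functional fs (tens xs) =
      (if length xs = length fs then prod_list (map2 (\<lambda>f x. f x) fs xs) else 0)"
proof -
  have "linear (\<lambda>a. if length (xs @ a # ys) = length fs
      then prod_list (map2 (\<lambda>f x. f x) fs (xs @ a # ys)) else 0)" for xs ys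
  proof (cases "length xs + Suc (length ys) = length fs")
    case True
    then show ?thesis
      using linear_prod_list_map2[of fs xs undefined ys, OF assms] by simp
  qed (simp add: linear_zero)
  then have ml: "multilinear (\<lambda>xs. if length xs = length fs
      then prod_list (map2 (\<lambda>f x. f x) fs xs) else 0)"
    unfolding multilinear_def by blast
  show "linear (tensor_functional fs)"
    unfolding tensor_functional_def by (rule linear_tensor_lift[OF ml])
  show "tensor_functional fs (tens xs) =
      (if length xs = length fs then prod_list (map2 (\<lambda>f x. f x) fs xs) else 0)"
    unfolding tensor_functional_def by (rule tensor_lift_tens[OF ml])
qed

lemma
  assumes "list_all linear fs"
  shows linear_tensor_maps_list: "linear (tensor_maps fs)"
    and tensor_maps_list_tens: "tensor_maps fs (tens xs) =
      (if length xs = length fs then foldr tensor_conc (map2 (\<lambda>f x. f x) fs xs) (tens []) else 0)"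
  using assms by (intro linear_tensor_maps tensor_maps_tens; auto simp: list_all_iff)+

lemma linear_composed: "linear f \<Longrightarrow> linear g \<Longrightarrow> linear (\<lambda>x. g (f x))"
  using linear_compose[of f g] by (simp add: o_def)

lemma tensor_linear_eqI:
  assumes "linear f" "linear g" "\<And>xs. f (tens xs) = g (tens xs)"
  shows "f t = g t"
  by (rule linear_eq_on_span[OF assms(1,2) _ tensor_in_span]) (use assms(3) in auto)

text \<open>By linearity only words matter, and there the product splits. The assumption on
  \<open>s\<close> fixes where a concatenated word is cut: a first block of another length,
  completed by \<open>t\<close> to the right total length, may give a nonzero left side while the
  right side vanishes.\<close>

lemma tensor_functional_conc:
  assumes fs: "list_all linear fs" and gs: "list_all linear gs"
    and s: "s \<in> tensor_power (length fs)"
  shows "tensor_functional (fs @ gs) (tensor_conc s t) = tensor_functional fs s * tensor_functional gs t"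
proof -
  have lin: "linear (tensor_functional fs)" "linear (tensor_functional gs)"
    "linear (tensor_functional (fs @ gs))"
    using fs gs by (auto intro!: linear_tensor_functional)
  show ?thesis
  proof (rule linear_eq_on_span[of "\<lambda>s. tensor_functional (fs @ gs) (tensor_conc s t)"
        "\<lambda>s. tensor_functional fs s * tensor_functional gs t", OF _ _ _ s[unfolded tensor_power_def]])
    show "linear (\<lambda>s. tensor_functional (fs @ gs) (tensor_conc s t))"
      by (rule linear_composed[OF linear_tensor_conc_left lin(3)])
    show "linear (\<lambda>s. tensor_functional fs s * tensor_functional gs t)"
      using lin(1) by (simp add: linear_iff algebra_simps)
    fix u :: "'a tensor" assume "u \<in> {tens xs |xs. length xs = length fs}"
    then obtain xs where u: "u = tens xs" "length xs = length fs" by blast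
    show "tensor_functional (fs @ gs) (tensor_conc u t) = tensor_functional fs u * tensor_functional gs t"
    proof (rule tensor_linear_eqI[of "\<lambda>t. tensor_functional (fs @ gs) (tensor_conc u t)"
          "\<lambda>t. tensor_functional fs u * tensor_functional gs t"])
      show "linear (\<lambda>t. tensor_functional (fs @ gs) (tensor_conc u t))"
        by (rule linear_composed[OF linear_tensor_conc_right lin(3)])
      show "linear (\<lambda>t. tensor_functional fs u * tensor_functional gs t)"
        using lin(2) by (simp add: linear_iff algebra_simps)
      show "tensor_functional (fs @ gs) (tensor_conc u (tens ys)) =
          tensor_functional fs u * tensor_functional gs (tens ys)" for ys
        using u fs gs by (simp add: tensor_conc_tens tensor_functional_tens)
    qed
  qed
qed

text \<open>Letters are expanded one at a time: prepending a letter of \<open>A\<close> maps the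
  span for the tail into the required span, and linearity in the first letter passes from
  \<open>A\<close> to \<open>span A\<close>.\<close>

lemma tens_in_span_listset:
  assumes "list_all2 (\<lambda>x A. x \<in> span A) xs As"
  shows "tens xs \<in> span (tens ` listset As)"
  using assms
proof (induction rule: list_all2_induct)
  case Nil
  then show ?case by (simp add: real_vector.span_base)
next
  case (Cons x xs A As)
  have *: "tensor_conc (tens1 a) (tens xs) \<in> span (tens ` listset (A # As))" if "a \<in> A" for a
  proof -
    have "tensor_conc (tens1 a) ` span (tens ` listset As) = span (tensor_conc (tens1 a) ` tens ` listset As)"
      by (rule real_vector.linear_span_image[OF linear_tensor_conc_right, symmetric])
    also have "\<dots> \<subseteq> span (tens ` listset (A # As))"
      using that by (intro real_vector.span_mono) (auto simp: tensor_conc_tens set_Cons_def)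
    finally show ?thesis using Cons by blast
  qed
  have lin: "linear (\<lambda>a. tens (a # xs))"
    using linear_tens[of "[]" xs] by simp
  have "(\<lambda>a. tens (a # xs)) ` span A = span ((\<lambda>a. tens (a # xs)) ` A)"
    by (rule real_vector.linear_span_image[OF lin, symmetric])
  also have "\<dots> \<subseteq> span (tens ` listset (A # As))"
    using * by (intro real_vector.span_minimal) (auto simp: tensor_conc_tens real_vector.subspace_span)
  finally show ?case using Cons by blast
qed

lemma in_listset_iff: "xs \<in> listset As \<longleftrightarrow> list_all2 (\<in>) xs As"
  by (induction As arbitrary: xs) (auto simp: set_Cons_def list_all2_Cons2)

lemma finite_listset: "(\<And>A. A \<in> set As \<Longrightarrow> finite A) \<Longrightarrow> finite (listset As)"
proof (induction As)
  case (Cons A As)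
  have "listset (A # As) = (\<lambda>(x, xs). x # xs) ` (A \<times> listset As)"
    by (auto simp: set_Cons_def)
  then show ?case using Cons by simp
qed simp

lemma linear_tens1: "linear tens1"
  using linear_tens[of "[]" "[]"] by simp

text \<open>Linearity in the left factor comes from the outer lift. For the right factor both sides
  of each identity are linear in \<open>s\<close>, so words suffice, and on a word the product is
  the inner lift.\<close>

lemma
  fixes s t :: "'a::real_algebra_1 tensor"
  shows linear_tensor_times_left: "linear (\<lambda>s. tensor_times s t)"
    and linear_tensor_times_right: "linear (\<lambda>t. tensor_times s t)"
proof -
  let ?f = "\<lambda>xs ys :: 'a list. if length xs = length ys then tens (map2 (*) xs ys) else 0"
  have 1: "multilinear (?f xs)" for xs :: "'a list"
    unfolding multilinear_def using linear_tens_map2(1) by blast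
  have 2: "multilinear (\<lambda>xs. tensor_lift (?f xs) t)" for t
    unfolding multilinear_def by (intro allI linear_via_lift 1 linear_tens_map2(2))
  show left: "linear (\<lambda>s. tensor_times s t)" for t :: "'a tensor"
    unfolding tensor_times_def by (rule linear_tensor_lift[OF 2])
  have lin: "linear (tensor_lift (?f xs))" for xs
    by (rule linear_tensor_lift[OF 1])
  have eq: "tensor_times (tens xs) t = tensor_lift (?f xs) t" for xs t
    unfolding tensor_times_def by (rule tensor_lift_tens[OF 2])
  show "linear (\<lambda>t. tensor_times s t)"
  proof (rule linearI)
    show "tensor_times s (t + u) = tensor_times s t + tensor_times s u" for t u
      by (rule tensor_linear_eqI[of "\<lambda>s. tensor_times s (t + u)"])
        (simp_all add: left linear_compose_add eq linear_add[OF lin])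
    show "tensor_times s (c *\<^sub>R t) = c *\<^sub>R tensor_times s t" for c t
      by (rule tensor_linear_eqI[of "\<lambda>s. tensor_times s (c *\<^sub>R t)"])
        (simp_all add: left linear_compose_scale_right eq linear_scale[OF lin])
  qed
qed

lemma linear_tensor_mult: "linear tensor_mult"
proof -
  have "multilinear (prod_list :: 'a list \<Rightarrow> 'a)"
    unfolding multilinear_def
    by (intro allI linearI) (simp_all add: distrib_left distrib_right)
  then show ?thesis
    unfolding tensor_mult_def by (rule linear_tensor_lift)
qed

lemma foldr_conc_replicate_tens1:
  "length xs = l \<Longrightarrow> foldr tensor_conc (map2 (\<lambda>f x. f x) (replicate l tens1) xs) (tens []) = tens xs"
  by (induction xs arbitrary: l) (auto simp: tensor_conc_tens)

lemma listset_replicate: "listset (replicate l A) = {ws. length ws = l \<and> set ws \<subseteq> A}"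
  by (induction l) (auto simp: set_Cons_def length_Suc_conv)

section \<open>Convolution of functionals and homogeneous components\<close>

context graded_connected_hopf_algebra
begin

section \<open>The convolution algebra of linear functionals\<close>

definition convolution :: "('a \<Rightarrow> real) \<Rightarrow> ('a \<Rightarrow> real) \<Rightarrow> 'a \<Rightarrow> real" where
  "convolution f g x = tensor_functional [f, g] (\<Delta> x)"

lemma linear_convolution: "linear f \<Longrightarrow> linear g \<Longrightarrow> linear (convolution f g)"
  unfolding convolution_def[abs_def]
  by (intro linear_composed[OF linear_coproduct] linear_tensor_functional) simp

lemma linear_foldr_convolution:
  "list_all linear fs \<Longrightarrow> linear g \<Longrightarrow> linear (foldr convolution fs g)"
  by (induction fs) (auto intro: linear_convolution)

lemma tensor_maps_coproduct_tens:
  "tensor_maps (\<Delta> # replicate l tens1) (tens xs) =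
    (if length xs = Suc l then tensor_conc (\<Delta> (hd xs)) (tens (tl xs)) else 0)"
proof -
  have "list_all linear (\<Delta> # replicate l tens1)"
    by (simp add: list_all_iff linear_coproduct linear_tens1)
  then show ?thesis
    by (auto simp: tensor_maps_list_tens foldr_conc_replicate_tens1 length_Suc_conv)
qed

lemma linear_tensor_maps_coproduct: "linear (tensor_maps (\<Delta> # replicate l tens1))"
  by (rule linear_tensor_maps_list) (simp add: list_all_iff linear_coproduct linear_tens1)

text \<open>The transpose of one step of \<open>iterated_coproduct\<close>: splitting the first
  tensor factor by \<Delta> amounts to merging the first two functionals into their
  convolution.\<close>

lemma tensor_functional_coproduct_head:
  assumes f: "linear f" and g: "linear g" and fs: "list_all linear fs"
  shows "tensor_functional (f # g # fs) (tensor_maps (\<Delta> # replicate (length fs) tens1) t) =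
    tensor_functional (convolution f g # fs) t"
proof (rule tensor_linear_eqI[of "\<lambda>t. tensor_functional (f # g # fs)
      (tensor_maps (\<Delta> # replicate (length fs) tens1) t)"])
  have l: "list_all linear (f # g # fs)" and l': "list_all linear (convolution f g # fs)"
    using f g fs by (simp_all add: linear_convolution)
  show "linear (\<lambda>t. tensor_functional (f # g # fs) (tensor_maps (\<Delta> # replicate (length fs) tens1) t))"
    by (rule linear_composed[OF linear_tensor_maps_coproduct linear_tensor_functional[OF l]])
  show "linear (tensor_functional (convolution f g # fs))"
    by (rule linear_tensor_functional[OF l'])
  show "tensor_functional (f # g # fs) (tensor_maps (\<Delta> # replicate (length fs) tens1) (tens xs)) =
      tensor_functional (convolution f g # fs) (tens xs)" for xs
  proof (cases "length xs = Suc (length fs)")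
    case True
    then obtain y ys where xs: "xs = y # ys" "length ys = length fs"
      by (auto simp: length_Suc_conv)
    have "tensor_functional ([f, g] @ fs) (tensor_conc (\<Delta> y) (tens ys)) =
        tensor_functional [f, g] (\<Delta> y) * tensor_functional fs (tens ys)"
      using f g fs coproduct_range by (intro tensor_functional_conc) (auto simp: numeral_2_eq_2)
    then show ?thesis
      using xs fs l'
      by (simp add: tensor_maps_coproduct_tens tensor_functional_tens convolution_def)
  next
    case False
    then show ?thesis
      using l' linear_0[OF linear_tensor_functional[OF l]]
      by (simp add: tensor_maps_coproduct_tens tensor_functional_tens)
  qed
qed

text \<open>Coassociativity, transposed. Evaluating \<open>[f, g, h]\<close> after splitting the
  left factor gives one bracketing (by \<open>tensor_functional_coproduct_head\<close>), after
  splitting the right factor the other.\<close>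

lemma convolution_assoc:
  assumes f: "linear f" and g: "linear g" and h: "linear h"
  shows "convolution (convolution f g) h = convolution f (convolution g h)"
proof
  fix x
  have l: "list_all linear [f, g, h]" "list_all linear [f, convolution g h]"
    "list_all linear [tens1, \<Delta>]"
    using f g h by (simp_all add: linear_convolution linear_tens1 linear_coproduct)
  have "tensor_functional [f, g, h] (tensor_maps [tens1, \<Delta>] t) =
      tensor_functional [f, convolution g h] t" for t
  proof (rule tensor_linear_eqI[of "\<lambda>t. tensor_functional [f, g, h] (tensor_maps [tens1, \<Delta>] t)"])
    show "linear (\<lambda>t. tensor_functional [f, g, h] (tensor_maps [tens1, \<Delta>] t))"
      by (rule linear_composed[OF linear_tensor_maps_list[OF l(3)] linear_tensor_functional[OF l(1)]])
    show "linear (tensor_functional [f, convolution g h])"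
      by (rule linear_tensor_functional[OF l(2)])
    show "tensor_functional [f, g, h] (tensor_maps [tens1, \<Delta>] (tens xs)) =
        tensor_functional [f, convolution g h] (tens xs)" for xs
    proof (cases "length xs = 2")
      case True
      then obtain a b where xs: "xs = [a, b]"
        by (auto simp: numeral_2_eq_2 length_Suc_conv)
      \<comment> \<open>The trailing \<open>tens []\<close> is the seed of the \<open>foldr\<close>
        in \<open>tensor_maps\<close>; it is split off below as an empty block of value 1.\<close>
      have "tensor_functional ([f] @ [g, h]) (tensor_conc (tens1 a) (tensor_conc (\<Delta> b) (tens []))) =
          tensor_functional [f] (tens1 a) * tensor_functional ([g, h] @ []) (tensor_conc (\<Delta> b) (tens []))"
        using f g h by (subst tensor_functional_conc)
          (auto simp: tensor_power_def intro!: real_vector.span_base)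
      also have "tensor_functional ([g, h] @ []) (tensor_conc (\<Delta> b) (tens [])) =
          tensor_functional [g, h] (\<Delta> b) * tensor_functional [] (tens [] :: 'a tensor)"
        using g h coproduct_range by (subst tensor_functional_conc) (auto simp: numeral_2_eq_2)
      finally show ?thesis
        using f l by (simp add: xs tensor_functional_tens tensor_maps_list_tens convolution_def)
    next
      case False
      then show ?thesis
        using l linear_0[OF linear_tensor_functional[OF l(1)]]
        by (simp add: tensor_functional_tens tensor_maps_list_tens)
    qed
  qed
  moreover have "tensor_functional [f, g, h] (tensor_maps [\<Delta>, tens1] (\<Delta> x)) =
      tensor_functional [convolution f g, h] (\<Delta> x)"
    using tensor_functional_coproduct_head[of f g "[h]"] f g h by simp
  ultimately show "convolution (convolution f g) h x = convolution f (convolution g h) x"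
    unfolding convolution_def[of "convolution f g"] convolution_def[of f "convolution g h"]
    by (simp add: coassociative)
qed

text \<open>The counit axioms composed with \<open>f\<close>: contracting one factor by \<epsilon>
  and then applying \<open>f\<close> is evaluation by the pair of functionals.\<close>

lemma
  assumes f: "linear f"
  shows convolution_counit_left: "convolution \<epsilon> f = f"
    and convolution_counit_right: "convolution f \<epsilon> = f"
proof -
  let ?e = "\<lambda>a. \<epsilon> a *\<^sub>R tens [] :: 'a tensor"
  have "linear ?e"
    using linear_counit by (simp add: linear_iff scaleR_add_left)
  then have l: "list_all linear [f]" "list_all linear [\<epsilon>, f]" "list_all linear [f, \<epsilon>]"
    and lm: "list_all linear [?e, tens1]" "list_all linear [tens1, ?e]"
    using f by (simp_all add: linear_tens1 linear_counit)
  note lf = linear_tensor_functional[OF l(1)]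
  have two: "\<exists>a b. xs = [a, b]" if "length xs = 2" for xs :: "'a list"
    using that by (auto simp: numeral_2_eq_2 length_Suc_conv)
  have "tensor_functional [f] (tensor_maps [?e, tens1] t) = tensor_functional [\<epsilon>, f] t" for t
  proof (rule tensor_linear_eqI[of "\<lambda>t. tensor_functional [f] (tensor_maps [?e, tens1] t)"])
    show "linear (\<lambda>t. tensor_functional [f] (tensor_maps [?e, tens1] t))"
      by (rule linear_composed[OF linear_tensor_maps_list[OF lm(1)] lf])
    show "linear (tensor_functional [\<epsilon>, f])"
      by (rule linear_tensor_functional[OF l(2)])
    show "tensor_functional [f] (tensor_maps [?e, tens1] (tens xs)) =
        tensor_functional [\<epsilon>, f] (tens xs)" for xs
      using l lm two[of xs]
      by (auto simp: tensor_functional_tens tensor_maps_list_tens tensor_conc_tens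
          linear_scale[OF linear_tensor_conc_left] linear_scale[OF lf] linear_0[OF lf])
  qed
  from this[of "\<Delta> _", unfolded counit_left] show "convolution \<epsilon> f = f"
    using l by (auto simp: convolution_def tensor_functional_tens)
  have "tensor_functional [f] (tensor_maps [tens1, ?e] t) = tensor_functional [f, \<epsilon>] t" for t
  proof (rule tensor_linear_eqI[of "\<lambda>t. tensor_functional [f] (tensor_maps [tens1, ?e] t)"])
    show "linear (\<lambda>t. tensor_functional [f] (tensor_maps [tens1, ?e] t))"
      by (rule linear_composed[OF linear_tensor_maps_list[OF lm(2)] lf])
    show "linear (tensor_functional [f, \<epsilon>])"
      by (rule linear_tensor_functional[OF l(3)])
    show "tensor_functional [f] (tensor_maps [tens1, ?e] (tens xs)) =
        tensor_functional [f, \<epsilon>] (tens xs)" for xs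
      using l lm two[of xs]
      by (auto simp: tensor_functional_tens tensor_maps_list_tens tensor_conc_tens
          linear_scale[OF linear_tensor_conc_left] linear_scale[OF linear_tensor_conc_right]
          linear_scale[OF lf] linear_0[OF lf])
  qed
  from this[of "\<Delta> _", unfolded counit_right] show "convolution f \<epsilon> = f"
    using l by (auto simp: convolution_def tensor_functional_tens)
qed

text \<open>Since the iterated coproduct always splits the first factor, the induction merges the
  first two functionals; associativity then moves the brackets to the right, as in
  \<open>foldr\<close>. The seed \<epsilon> is the value for the empty list and disappears from a
  singleton by the right counit law.\<close>

lemma tensor_functional_iterated_coproduct:
  assumes "list_all linear fs"
  shows "tensor_functional fs (iterated_coproduct \<Delta> \<epsilon> (length fs) x) = foldr convolution fs \<epsilon> x"
  using assms
proof (induction "length fs" arbitrary: fs rule: less_induct)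
  case less
  consider "fs = []" | f where "fs = [f]" | f g gs where "fs = f # g # gs"
    by (metis list.exhaust)
  then show ?case
  proof cases
    case 1
    then show ?thesis
      by (simp add: linear_scale[OF linear_tensor_functional] tensor_functional_tens)
  next
    case 2
    with less(2) show ?thesis
      by (simp add: tensor_functional_tens convolution_counit_right)
  next
    case 3
    then have l: "linear f" "linear g" "list_all linear gs"
      using less(2) by auto
    then have lr: "linear (foldr convolution gs \<epsilon>)"
      by (intro linear_foldr_convolution linear_counit)
    have "tensor_functional fs (iterated_coproduct \<Delta> \<epsilon> (length fs) x) =
        tensor_functional (convolution f g # gs) (iterated_coproduct \<Delta> \<epsilon> (length (convolution f g # gs)) x)"
      using l by (simp add: 3 tensor_functional_coproduct_head)
    also have "\<dots> = foldr convolution (convolution f g # gs) \<epsilon> x"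
      by (rule less(1)) (use l 3 linear_convolution in auto)
    also have "\<dots> = foldr convolution fs \<epsilon> x"
      using l lr by (simp add: 3 convolution_assoc)
    finally show ?thesis .
  qed
qed

text \<open>As \<Delta> is multiplicative, product rules for \<open>f\<close> and \<open>g\<close>
  combine into one for their convolution. In the application \<open>I\<close> indexes the two terms
  of a derivation rule and \<open>J\<close> the terms of a Leibniz sum with binomial weights
  \<open>c\<close>.\<close>

lemma convolution_mult:
  fixes f1 f2 :: "'i \<Rightarrow> 'a \<Rightarrow> real" and g1 g2 :: "'j \<Rightarrow> 'a \<Rightarrow> real" and c :: "'j \<Rightarrow> real"
  assumes f: "linear f" "\<And>p. linear (f1 p)" "\<And>p. linear (f2 p)"
    and g: "linear g" "\<And>q. linear (g1 q)" "\<And>q. linear (g2 q)"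
    and f_mult: "\<And>a b. f (a * b) = (\<Sum>p\<in>I. f1 p a * f2 p b)"
    and g_mult: "\<And>a b. g (a * b) = (\<Sum>q\<in>J. c q * (g1 q a * g2 q b))"
  shows "convolution f g (a * b) =
    (\<Sum>p\<in>I. \<Sum>q\<in>J. c q * (convolution (f1 p) (g1 q) a * convolution (f2 p) (g2 q) b))"
proof -
  have l: "list_all linear [f, g]" "list_all linear [f1 p, g1 q]" "list_all linear [f2 p, g2 q]" for p q
    using f g by simp_all
  note lin = linear_tensor_functional[OF l(1)] linear_tensor_functional[OF l(2)]
    linear_tensor_functional[OF l(3)]
  have two: "\<exists>a b. xs = [a, b]" if "length xs = 2" for xs :: "'a list"
    using that by (auto simp: numeral_2_eq_2 length_Suc_conv)
  let ?R = "\<lambda>s t. \<Sum>p\<in>I. \<Sum>q\<in>J. c q * (tensor_functional [f1 p, g1 q] s * tensor_functional [f2 p, g2 q] t)"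
  have linR: "linear (\<lambda>s. ?R s t)" "linear (\<lambda>t. ?R s t)" for s t
    by (intro linear_compose_sum ballI linearI;
        simp add: linear_add[OF lin(2)] linear_add[OF lin(3)] linear_scale[OF lin(2)]
          linear_scale[OF lin(3)] algebra_simps)+
  have "tensor_functional [f, g] (tensor_times s t) = ?R s t"
    if s: "s \<in> tensor_power 2" and t: "t \<in> tensor_power 2" for s t
  proof (rule linear_eq_on_span[of "\<lambda>s. tensor_functional [f, g] (tensor_times s t)" "\<lambda>s. ?R s t",
        OF linear_composed[OF linear_tensor_times_left lin(1)] linR(1) _ s[unfolded tensor_power_def]])
    fix s :: "'a tensor" assume "s \<in> {tens xs |xs. length xs = 2}"
    then obtain a1 a2 where s: "s = tens [a1, a2]"
      using two by blast
    show "tensor_functional [f, g] (tensor_times s t) = ?R s t"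
    proof (rule linear_eq_on_span[of "\<lambda>t. tensor_functional [f, g] (tensor_times s t)" "\<lambda>t. ?R s t",
          OF linear_composed[OF linear_tensor_times_right lin(1)] linR(2) _ t[unfolded tensor_power_def]])
      fix t :: "'a tensor" assume "t \<in> {tens xs |xs. length xs = 2}"
      then obtain b1 b2 where t: "t = tens [b1, b2]"
        using two by blast
      have "tensor_functional [f, g] (tensor_times s t) = f (a1 * b1) * g (a2 * b2)"
        by (simp add: s t tensor_times_tens tensor_functional_tens[OF l(1)])
      also have "\<dots> = ?R s t"
        unfolding f_mult g_mult
        by (simp add: s t sum_product tensor_functional_tens[OF l(2)] tensor_functional_tens[OF l(3)] mult_ac)
      finally show "tensor_functional [f, g] (tensor_times s t) = ?R s t" .
    qed
  qed
  from this[OF coproduct_range coproduct_range] show ?thesis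
    by (simp add: convolution_def coproduct_mult)
qed

text \<open>Each step replaces one letter by an element of the second tensor power and so raises the
  length by one. Hence coefficients over words of length \<open>l\<close> describe the whole
  iterated coproduct.\<close>

lemma iterated_coproduct_range: "iterated_coproduct \<Delta> \<epsilon> l x \<in> tensor_power l"
proof (induction l rule: induct_nat_012)
  case 0
  then show ?case
    by (simp add: tensor_power_def real_vector.span_base real_vector.span_scale)
next
  case 1
  then show ?case
    by (auto simp: tensor_power_def intro!: real_vector.span_base)
next
  case (ge2 l)
  have conc: "tensor_conc s (tens ys) \<in> tensor_power (Suc (Suc l))"
    if s: "s \<in> tensor_power 2" and "length ys = l" for s and ys :: "'a list"
  proof -
    have "(\<lambda>s. tensor_conc s (tens ys)) ` tensor_power 2 =
        span ((\<lambda>s. tensor_conc s (tens ys)) ` {tens xs |xs. length xs = 2})"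
      unfolding tensor_power_def
      by (rule real_vector.linear_span_image[OF linear_tensor_conc_left, symmetric])
    also have "\<dots> \<subseteq> tensor_power (Suc (Suc l))"
      unfolding tensor_power_def using that(2)
      by (intro real_vector.span_mono) (auto simp: tensor_conc_tens)
    finally show ?thesis
      using s by blast
  qed
  have "tensor_maps (\<Delta> # replicate l tens1) ` tensor_power (Suc l) =
      span (tensor_maps (\<Delta> # replicate l tens1) ` {tens xs |xs. length xs = Suc l})"
    unfolding tensor_power_def
    by (rule real_vector.linear_span_image[OF linear_tensor_maps_coproduct, symmetric])
  also have "\<dots> \<subseteq> tensor_power (Suc (Suc l))"
  proof (rule real_vector.span_minimal)
    show "tensor_maps (\<Delta> # replicate l tens1) ` {tens xs |xs. length xs = Suc l} \<subseteq> tensor_power (Suc (Suc l))"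
      using conc[OF coproduct_range] by (auto simp: length_Suc_conv tensor_maps_coproduct_tens)
  qed (simp add: tensor_power_def)
  finally show ?case
    using ge2(2) by auto
qed

section \<open>Projections onto the graded pieces\<close>

lemma graded_decomposition_component: "graded_decomposition H x (\<lambda>i. graded_component H i x)"
  unfolding graded_component_def using theI'[OF direct_sum] .

lemma graded_component_eqI: "graded_decomposition H x f \<Longrightarrow> graded_component H i x = f i"
  unfolding graded_component_def using the1_equality[OF direct_sum] by metis

lemma graded_component_in: "graded_component H i x \<in> H i"
  using graded_decomposition_component unfolding graded_decomposition_def by blast

lemma graded_decompositionI:
  assumes "\<And>i. f i \<in> H i" "finite A" "\<And>i. i \<notin> A \<Longrightarrow> f i = 0" "x = sum f A"
  shows "graded_decomposition H x f"
proof -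
  have sub: "{i. f i \<noteq> 0} \<subseteq> A"
    using assms(3) by blast
  have "sum f A = (\<Sum>i | f i \<noteq> 0. f i)"
    using assms(2) sub by (intro sum.mono_neutral_right) auto
  then show ?thesis
    unfolding graded_decomposition_def using assms finite_subset[OF sub] by simp
qed

lemma sum_graded_component:
  "\<exists>A. finite A \<and> (\<forall>i. i \<notin> A \<longrightarrow> graded_component H i x = 0) \<and> x = (\<Sum>i\<in>A. graded_component H i x)"
  using graded_decomposition_component[of x] unfolding graded_decomposition_def by blast

text \<open>Adding or scaling decompositions termwise gives a decomposition of the result, which is
  the only one. For sums the two supports are first enlarged to a common finite index set.\<close>

lemma linear_graded_component: "linear (graded_component H i)"
proof (rule linearI)
  fix x y
  obtain A where A: "finite A" "\<And>i. i \<notin> A \<Longrightarrow> graded_component H i x = 0"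
    "x = (\<Sum>i\<in>A. graded_component H i x)" using sum_graded_component[of x] by blast
  obtain C where C: "finite C" "\<And>i. i \<notin> C \<Longrightarrow> graded_component H i y = 0"
    "y = (\<Sum>i\<in>C. graded_component H i y)" using sum_graded_component[of y] by blast
  have "x = (\<Sum>i\<in>A \<union> C. graded_component H i x)" "y = (\<Sum>i\<in>A \<union> C. graded_component H i y)"
    by (subst A(3) C(3), rule sum.mono_neutral_left; use A(1,2) C(1,2) in auto)+
  then have "x + y = (\<Sum>i\<in>A \<union> C. graded_component H i x + graded_component H i y)"
    by (simp add: sum.distrib)
  then have "graded_decomposition H (x + y) (\<lambda>i. graded_component H i x + graded_component H i y)"
    using A(1,2) C(1,2)
    by (intro graded_decompositionI[where A = "A \<union> C"])
      (auto intro!: subspace_add[OF subspace_grade] graded_component_in)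
  then show "graded_component H i (x + y) = graded_component H i x + graded_component H i y"
    by (rule graded_component_eqI)
next
  fix c x
  obtain A where A: "finite A" "\<And>i. i \<notin> A \<Longrightarrow> graded_component H i x = 0"
    "x = (\<Sum>i\<in>A. graded_component H i x)" using sum_graded_component[of x] by blast
  have "c *\<^sub>R x = (\<Sum>i\<in>A. c *\<^sub>R graded_component H i x)"
    by (subst A(3)) (rule scaleR_sum_right)
  then have "graded_decomposition H (c *\<^sub>R x) (\<lambda>i. c *\<^sub>R graded_component H i x)"
    using A(1,2) by (intro graded_decompositionI[where A = A])
      (auto intro!: subspace_scale[OF subspace_grade] graded_component_in)
  then show "graded_component H i (c *\<^sub>R x) = c *\<^sub>R graded_component H i x"
    by (rule graded_component_eqI)
qed

lemma graded_component_homogeneous: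
  assumes "x \<in> H m"
  shows "graded_component H i x = (if i = m then x else 0)"
  by (rule graded_component_eqI, rule graded_decompositionI[where A = "{m}"])
    (use assms subspace_0[OF subspace_grade] in auto)

lemma graded_component_idem [simp]:
  "graded_component H i (graded_component H i x) = graded_component H i x"
  using graded_component_homogeneous[OF graded_component_in] by simp

text \<open>All components except the one in degree \<open>d\<close> are killed by \<open>f\<close>.
  This is how functionals absorb the projections inside \<open>coproduct_comp\<close>.\<close>

lemma linear_eq_component:
  assumes f: "linear f" and van: "\<And>k y. y \<in> H k \<Longrightarrow> k \<noteq> d \<Longrightarrow> f y = 0"
  shows "f (graded_component H d x) = f x"
proof -
  obtain A where A: "finite A" "\<And>i. i \<notin> A \<Longrightarrow> graded_component H i x = 0"
    "x = (\<Sum>i\<in>A. graded_component H i x)" using sum_graded_component[of x] by blast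
  have "f x = (\<Sum>i\<in>A. f (graded_component H i x))"
    by (subst A(3)) (rule linear_sum[OF f])
  also have "\<dots> = (\<Sum>i\<in>A. if i = d then f (graded_component H d x) else 0)"
    using van graded_component_in by (intro sum.cong) auto
  also have "\<dots> = f (graded_component H d x)"
    using A(1) A(2)[of d] linear_0[OF f] by auto
  finally show ?thesis ..
qed

lemma linear_grade_eqI:
  assumes "linear f" "linear g" "\<And>i x. x \<in> H i \<Longrightarrow> f x = g x"
  shows "f x = g x"
proof -
  obtain A where A: "finite A" "\<And>i. i \<notin> A \<Longrightarrow> graded_component H i x = 0"
    "x = (\<Sum>i\<in>A. graded_component H i x)" using sum_graded_component[of x] by blast
  show ?thesis
    by (subst (1 2) A(3))
      (auto simp: linear_sum[OF assms(1)] linear_sum[OF assms(2)] intro!: sum.cong assms(3) graded_component_in)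
qed

end

section \<open>Convolution powers and the function eta\<close>

lemma multinomial_Nil: "multinomial [] = 1"
  by (simp add: multinomial_def)

lemma multinomial_Cons:
  "multinomial (d # D) = real ((d + sum_list D) choose d) * multinomial D"
  by (simp add: multinomial_def binomial_fact)

lemma multinomial_pos: "multinomial D > 0"
  by (induction D) (simp_all add: multinomial_Nil multinomial_Cons)

locale based_hopf_algebra = graded_connected_hopf_algebra H \<Delta> \<epsilon> S
  for H :: "nat \<Rightarrow> 'a::real_algebra_1 set" and \<Delta> \<epsilon> S +
  fixes B :: "nat \<Rightarrow> 'a set"
  assumes finite_dim: "\<exists>F. finite F \<and> span F = H m"
    and basis: "graded_basis H B"
begin

section \<open>The homogeneous basis and its coordinate functionals\<close>

abbreviation U :: "'a set" where "U \<equiv> \<Union>m. B m"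

abbreviation coord :: "'a \<Rightarrow> 'a \<Rightarrow> real" where "coord z x \<equiv> representation U x z"

lemma independent_B: "independent (B m)" and span_B: "span (B m) = H m"
  using basis unfolding graded_basis_def by blast+

lemma finite_B: "finite (B m)"
proof -
  obtain F where F: "finite F" "span F = H m"
    using finite_dim by blast
  have "B m \<subseteq> span F"
    unfolding F(2) span_B[symmetric] by (rule real_vector.span_superset)
  with F(1) independent_B show ?thesis
    using real_vector.independent_span_bound by blast
qed

lemma B_subset: "x \<in> B m \<Longrightarrow> x \<in> H m"
  using span_B real_vector.span_superset by blast

lemma graded_component_basis: "x \<in> B m \<Longrightarrow> graded_component H i x = (if i = m then x else 0)"
  by (rule graded_component_homogeneous[OF B_subset])

text \<open>Built from the basis of a single degree, these functionals are available before
  \<open>U\<close> is known to be independent, and they are the dual family that proves it.\<close>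

lemma linear_representation_component:
  "linear (\<lambda>x. representation (B m) (graded_component H m x) z)"
proof (rule linearI)
  have sp: "graded_component H m x \<in> span (B m)" for x
    unfolding span_B by (rule graded_component_in)
  show "representation (B m) (graded_component H m (x + y)) z =
      representation (B m) (graded_component H m x) z + representation (B m) (graded_component H m y) z" for x y
    by (simp add: linear_add[OF linear_graded_component] real_vector.representation_add[OF independent_B sp sp])
  show "representation (B m) (graded_component H m (c *\<^sub>R x)) z =
      c *\<^sub>R representation (B m) (graded_component H m x) z" for c x
    by (simp add: linear_scale[OF linear_graded_component] real_vector.representation_scale[OF independent_B sp])
qed

text \<open>Indexing by pairs of a degree and a basis vector means that disjointness of the sets
  \<open>B m\<close> need not be known beforehand.\<close>

lemma representation_component_dual:
  assumes "p \<in> Sigma UNIV B" "q \<in> Sigma UNIV B"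
  shows "representation (B (fst p)) (graded_component H (fst p) (snd q)) (snd p) = of_bool (p = q)"
  using assms
  by (auto simp: graded_component_basis real_vector.representation_basis[OF independent_B]
      real_vector.representation_zero split: if_splits)

lemma snd_image_Sigma: "snd ` Sigma UNIV B = U"
  by force

lemma independent_U: "independent U"
  using dual_family_independent[of "Sigma UNIV B" "\<lambda>p x. representation (B (fst p)) (graded_component H (fst p) x) (snd p)" snd,
      OF linear_representation_component representation_component_dual]
  unfolding snd_image_Sigma by blast

lemma span_U: "span U = UNIV"
proof -
  have "x \<in> span U" for x
  proof -
    obtain A where A: "x = (\<Sum>i\<in>A. graded_component H i x)"
      using sum_graded_component[of x] by blast
    have "graded_component H i x \<in> span U" for i
      using graded_component_in[of i x, folded span_B] real_vector.span_mono[of "B i" U] by blast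
    then show ?thesis
      by (subst A) (rule real_vector.span_sum)
  qed
  then show ?thesis by blast
qed

lemma linear_coord: "linear (coord z)"
  by (rule linearI)
    (simp_all add: real_vector.representation_add[OF independent_U] span_U
      real_vector.representation_scale[OF independent_U])

lemma coord_basis: "w \<in> U \<Longrightarrow> coord z w = of_bool (z = w)"
  using real_vector.representation_basis[OF independent_U] by auto

lemma coord_eq_representation_component:
  "z \<in> B m \<Longrightarrow> coord z x = representation (B m) (graded_component H m x) z"
  using dual_family_representation[of "Sigma UNIV B" "\<lambda>p x. representation (B (fst p)) (graded_component H (fst p) x) (snd p)" snd x "(m, z)",
      OF linear_representation_component representation_component_dual]
  unfolding snd_image_Sigma by (simp add: span_U)

lemma coord_component: "z \<in> B m \<Longrightarrow> coord z (graded_component H m x) = coord z x"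
  by (simp add: coord_eq_representation_component)

lemma homogeneous_expansion:
  fixes F :: "'a \<Rightarrow> 'w::real_vector"
  assumes "linear F" "x \<in> H m"
  shows "F x = (\<Sum>y\<in>B m. coord y x *\<^sub>R F y)"
proof (rule dual_family_expand[of "B m" coord "\<lambda>y. y", OF linear_coord _ finite_B assms(1)])
  show "coord i j = of_bool (i = j)" if "j \<in> B m" for i j
    using that by (intro coord_basis) blast
qed (simp add: span_B assms(2))

section \<open>Coefficients of iterated and projected coproducts\<close>

lemma prod_list_coord:
  assumes "length zs = length ws" "set ws \<subseteq> U"
  shows "prod_list (map2 (\<lambda>f x. f x) (map coord zs) ws) = of_bool (zs = ws)"
  using assms by (induction zs ws rule: list_induct2) (auto simp: coord_basis)

lemma list_all_linear_coord: "list_all linear (map coord zs)"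
  by (simp add: list_all_iff linear_coord)

lemma tensor_functional_coord:
  assumes "length zs = l" "length ws = l" "set ws \<subseteq> U"
  shows "tensor_functional (map coord zs) (tens ws) = of_bool (zs = ws)"
  using assms prod_list_coord[of zs ws]
  by (simp add: tensor_functional_tens[OF list_all_linear_coord])

lemma tensor_functional_coord_dual:
  assumes "W \<subseteq> {ws. length ws = l \<and> set ws \<subseteq> U}" "zs \<in> W" "ws \<in> W"
  shows "tensor_functional (map coord zs) (tens ws) = of_bool (zs = ws)"
  by (rule tensor_functional_coord[where l = l]) (use assms in blast)+

text \<open>Products of coordinate functionals are dual to the tensor words over \<open>U\<close>.
  The right side does not mention \<open>W\<close>, so a coefficient is the same whether it is taken
  among all words over \<open>U\<close> or only among those with prescribed degrees.\<close>

lemma tensor_coeff_eq: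
  assumes W: "W \<subseteq> {ws. length ws = l \<and> set ws \<subseteq> U}" and t: "t \<in> span (tens ` W)" and zs: "zs \<in> W"
  shows "tensor_coeff W t zs = tensor_functional (map coord zs) t"
  unfolding tensor_coeff_def
  by (rule dual_family_representation[of W "\<lambda>zs. tensor_functional (map coord zs)" tens,
        OF linear_tensor_functional[OF list_all_linear_coord] tensor_functional_coord_dual[OF W] t zs])

lemma listset_map_B_subset: "listset (map B D) \<subseteq> {ws. length ws = length D \<and> set ws \<subseteq> U}"
  by (auto simp: in_listset_iff list_all2_conv_all_nth in_set_conv_nth) blast

lemma coproduct_coeff_eq:
  assumes "set zs \<subseteq> U"
  shows "coproduct_coeff \<Delta> \<epsilon> B x zs =
    tensor_functional (map coord zs) (iterated_coproduct \<Delta> \<epsilon> (length zs) x)"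
proof -
  let ?W = "{ws. length ws = length zs \<and> set ws \<subseteq> U}"
  have "tens ws \<in> span (tens ` ?W)" if "length ws = length zs" for ws :: "'a list"
    using tens_in_span_listset[of ws "replicate (length zs) U"] that
    by (simp add: listset_replicate list_all2_conv_all_nth span_U)
  then have "tensor_power (length zs) \<subseteq> span (tens ` ?W)"
    unfolding tensor_power_def by (intro real_vector.span_minimal) auto
  then show ?thesis
    unfolding coproduct_coeff_def using iterated_coproduct_range assms
    by (intro tensor_coeff_eq) auto
qed

lemma list_all_linear_component: "list_all linear (map (\<lambda>d. tens1 \<circ> graded_component H d) D)"
  by (auto simp: list_all_iff intro!: linear_compose linear_graded_component linear_tens1)

lemma tensor_maps_component_tens:
  "tensor_maps (map (\<lambda>d. tens1 \<circ> graded_component H d) D) (tens xs) =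
    (if length xs = length D then tens (map2 (graded_component H) D xs) else 0)"
proof -
  have "foldr tensor_conc (map2 (\<lambda>f x. f x) (map (\<lambda>d. tens1 \<circ> graded_component H d) D) xs) (tens []) =
      tens (map2 (graded_component H) D xs)" if "length xs = length D"
    using that by (induction xs D rule: list_induct2) (simp_all add: tensor_conc_tens)
  then show ?thesis
    by (simp add: tensor_maps_list_tens[OF list_all_linear_component])
qed

lemma coproduct_comp_range: "coproduct_comp H \<Delta> \<epsilon> D x \<in> span (tens ` listset (map B D))"
proof -
  let ?M = "tensor_maps (map (\<lambda>d. tens1 \<circ> graded_component H d) D)"
  have "?M ` span (range tens) = span (?M ` range tens)"
    by (rule real_vector.linear_span_image[OF linear_tensor_maps_list[OF list_all_linear_component], symmetric])
  also have "\<dots> \<subseteq> span (tens ` listset (map B D))"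
  proof (rule real_vector.span_minimal)
    have "tens (map2 (graded_component H) D xs) \<in> span (tens ` listset (map B D))"
      if "length xs = length D" for xs
      using that by (intro tens_in_span_listset)
        (simp add: list_all2_conv_all_nth span_B graded_component_in)
    then show "?M ` range tens \<subseteq> span (tens ` listset (map B D))"
      by (auto simp: tensor_maps_component_tens real_vector.span_zero)
  qed simp
  finally show ?thesis
    unfolding coproduct_comp_def using tensor_in_span by blast
qed

lemma tensor_functional_coproduct_comp:
  assumes "list_all2 (\<lambda>f d. linear f \<and> (\<forall>x. f (graded_component H d x) = f x)) fs D"
  shows "tensor_functional fs (coproduct_comp H \<Delta> \<epsilon> D x) =
    tensor_functional fs (iterated_coproduct \<Delta> \<epsilon> (length D) x)"
proof -
  have len: "length fs = length D"
    using assms by (rule list_all2_lengthD)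
  have lin: "list_all linear fs"
    using assms len by (auto simp: list_all2_conv_all_nth list_all_length)
  have "tensor_functional fs (tensor_maps (map (\<lambda>d. tens1 \<circ> graded_component H d) D) t) =
      tensor_functional fs t" for t
  proof (rule tensor_linear_eqI[of "\<lambda>t. tensor_functional fs (tensor_maps _ t)"])
    show "linear (\<lambda>t. tensor_functional fs (tensor_maps (map (\<lambda>d. tens1 \<circ> graded_component H d) D) t))"
      by (rule linear_composed[OF linear_tensor_maps_list[OF list_all_linear_component] linear_tensor_functional[OF lin]])
    show "linear (tensor_functional fs)"
      by (rule linear_tensor_functional[OF lin])
    have "map2 (\<lambda>f x. f x) fs (map2 (graded_component H) D xs) = map2 (\<lambda>f x. f x) fs xs"
      if "length xs = length D" for xs
      using assms that by (auto simp: list_eq_iff_nth_eq list_all2_conv_all_nth)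
    then show "tensor_functional fs (tensor_maps (map (\<lambda>d. tens1 \<circ> graded_component H d) D) (tens xs)) =
        tensor_functional fs (tens xs)" for xs
      by (simp add: tensor_maps_component_tens tensor_functional_tens[OF lin] len
          linear_0[OF linear_tensor_functional[OF lin]])
  qed
  then show ?thesis
    unfolding coproduct_comp_def .
qed

text \<open>For \<open>z\<close> in \<open>B d\<close> the functional \<open>coord z\<close> ignores
  all degrees but \<open>d\<close>. This identifies the coefficients in the state space condition
  with the structure constants of the breaking step.\<close>

lemma tensor_coeff_coproduct_comp:
  assumes "zs \<in> listset (map B D)"
  shows "tensor_coeff (listset (map B D)) (coproduct_comp H \<Delta> \<epsilon> D x) zs = coproduct_coeff \<Delta> \<epsilon> B x zs"
    and "coproduct_coeff \<Delta> \<epsilon> B x zs = tensor_functional (map coord zs) (coproduct_comp H \<Delta> \<epsilon> D x)"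
proof -
  have zs: "length zs = length D" "set zs \<subseteq> U"
    using assms listset_map_B_subset by auto
  have "list_all2 (\<lambda>f d. linear f \<and> (\<forall>x. f (graded_component H d x) = f x)) (map coord zs) D"
    using assms by (auto simp: in_listset_iff list_all2_conv_all_nth linear_coord coord_component)
  from tensor_functional_coproduct_comp[OF this, of x]
  show 1: "coproduct_coeff \<Delta> \<epsilon> B x zs = tensor_functional (map coord zs) (coproduct_comp H \<Delta> \<epsilon> D x)"
    by (simp add: coproduct_coeff_eq zs)
  show "tensor_coeff (listset (map B D)) (coproduct_comp H \<Delta> \<epsilon> D x) zs = coproduct_coeff \<Delta> \<epsilon> B x zs"
    unfolding 1 by (rule tensor_coeff_eq[OF listset_map_B_subset coproduct_comp_range assms])
qed

lemma finite_listset_B: "finite (listset (map B D))"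
  by (rule finite_listset) (auto simp: finite_B)

lemma coproduct_comp_expansion:
  fixes F :: "'a tensor \<Rightarrow> 'w::real_vector"
  assumes "linear F"
  shows "F (coproduct_comp H \<Delta> \<epsilon> D x) = (\<Sum>zs\<in>listset (map B D). coproduct_coeff \<Delta> \<epsilon> B x zs *\<^sub>R F (tens zs))"
proof -
  have "F (coproduct_comp H \<Delta> \<epsilon> D x) = (\<Sum>zs\<in>listset (map B D).
      tensor_functional (map coord zs) (coproduct_comp H \<Delta> \<epsilon> D x) *\<^sub>R F (tens zs))"
    by (rule dual_family_expand[of _ "\<lambda>zs. tensor_functional (map coord zs)" tens,
          OF linear_tensor_functional[OF list_all_linear_coord]
            tensor_functional_coord_dual[OF listset_map_B_subset]
            finite_listset_B assms coproduct_comp_range])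
  also have "\<dots> = (\<Sum>zs\<in>listset (map B D). coproduct_coeff \<Delta> \<epsilon> B x zs *\<^sub>R F (tens zs))"
    by (intro sum.cong) (simp_all add: tensor_coeff_coproduct_comp(2))
  finally show ?thesis .
qed

text \<open>The functionals are evaluated on the projected coproduct in two ways: term by term in
  the basis of words, and as an iterated convolution.\<close>

lemma sum_coproduct_coeff_functionals:
  assumes "list_all2 (\<lambda>f d. linear f \<and> (\<forall>x. f (graded_component H d x) = f x)) fs D"
  shows "(\<Sum>zs\<in>listset (map B D). coproduct_coeff \<Delta> \<epsilon> B x zs * prod_list (map2 (\<lambda>f x. f x) fs zs)) =
    foldr convolution fs \<epsilon> x"
proof -
  have len: "length fs = length D"
    using assms by (rule list_all2_lengthD)
  have lin: "list_all linear fs"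
    using assms len by (auto simp: list_all2_conv_all_nth list_all_length)
  have "foldr convolution fs \<epsilon> x = tensor_functional fs (coproduct_comp H \<Delta> \<epsilon> D x)"
    using tensor_functional_iterated_coproduct[OF lin, of x] tensor_functional_coproduct_comp[OF assms, of x] len
    by simp
  also have "\<dots> = (\<Sum>zs\<in>listset (map B D). coproduct_coeff \<Delta> \<epsilon> B x zs *\<^sub>R tensor_functional fs (tens zs))"
    by (rule coproduct_comp_expansion[OF linear_tensor_functional[OF lin]])
  also have "\<dots> = (\<Sum>zs\<in>listset (map B D). coproduct_coeff \<Delta> \<epsilon> B x zs * prod_list (map2 (\<lambda>f x. f x) fs zs))"
    using listset_map_B_subset[of D] by (intro sum.cong) (auto simp: tensor_functional_tens[OF lin] len)
  finally show ?thesis ..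
qed

section \<open>Convolution powers of \<lambda> and the total breaking weight\<close>

text \<open>The functional \<lambda>. No projection to degree one is written, since coordinates at
  elements of \<open>B 1\<close> vanish on the other degrees.\<close>

definition degree_one :: "'a \<Rightarrow> real" where
  "degree_one x = (\<Sum>c\<in>B 1. coord c x)"

text \<open>Starts from \<epsilon>, the unit for convolution. It stands in for \<open>eta\<close> on
  \<open>B k\<close> (see \<open>eta_basis\<close>) and is linear by construction.\<close>

definition eta_power :: "nat \<Rightarrow> 'a \<Rightarrow> real" where
  "eta_power k = (convolution degree_one ^^ k) \<epsilon>"

lemma eta_power_simps: "eta_power 0 = \<epsilon>" "eta_power (Suc k) = convolution degree_one (eta_power k)"
  by (simp_all add: eta_power_def)

lemma linear_degree_one: "linear degree_one"
  unfolding degree_one_def[abs_def] by (intro linear_compose_sum ballI linear_coord)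

lemma linear_eta_power: "linear (eta_power k)"
  by (induction k) (simp_all add: eta_power_simps linear_counit linear_convolution linear_degree_one)

lemma degree_one_component: "degree_one (graded_component H 1 x) = degree_one x"
  by (simp add: degree_one_def coord_component)

lemma degree_one_homogeneous: "x \<in> H k \<Longrightarrow> k \<noteq> 1 \<Longrightarrow> degree_one x = 0"
  using degree_one_component[of x] graded_component_homogeneous[of x k 1] linear_0[OF linear_degree_one]
  by simp

lemma degree_one_basis:
  assumes "c \<in> B 1"
  shows "degree_one c = 1"
proof -
  have "c \<in> U"
    using assms by blast
  then have "degree_one c = (\<Sum>z\<in>B 1. if z = c then 1 else 0)"
    unfolding degree_one_def by (intro sum.cong) (auto simp: coord_basis)
  then show ?thesis
    using assms by (simp add: finite_B)
qed

text \<open>Because \<Delta> is graded, a term of bidegree \<open>(i, j)\<close> of \<Delta> x has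
  \<open>i + j = k\<close>; if \<open>k\<close> differs from \<open>Suc d\<close>, then
  \<open>i\<close> differs from 1 or \<open>j\<close> from \<open>d\<close>, and one of the two
  factors vanishes.\<close>

lemma eta_power_homogeneous: "x \<in> H k \<Longrightarrow> k \<noteq> d \<Longrightarrow> eta_power d x = 0"
proof (induction d arbitrary: k x)
  case 0
  then show ?case by (simp add: eta_power_simps counit_graded)
next
  case (Suc d)
  have l: "list_all linear [degree_one, eta_power d]"
    by (simp add: linear_degree_one linear_eta_power)
  have "tensor_functional [degree_one, eta_power d] (\<Delta> x) = 0"
  proof (rule linear_eq_0_on_span[OF linear_tensor_functional[OF l] _ coproduct_graded[OF Suc.prems(1)]])
    fix t assume "t \<in> {tens [a, b] |a b i j. a \<in> H i \<and> b \<in> H j \<and> i + j = k}"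
    then obtain a b i j where t: "t = tens [a, b]" "a \<in> H i" "b \<in> H j" "i + j = k"
      by blast
    then have "i \<noteq> 1 \<or> j \<noteq> d"
      using Suc.prems(2) by auto
    then have "degree_one a * eta_power d b = 0"
      using t Suc.IH degree_one_homogeneous by auto
    then show "tensor_functional [degree_one, eta_power d] t = 0"
      by (simp add: t tensor_functional_tens[OF l])
  qed
  then show ?case
    by (simp add: eta_power_simps convolution_def)
qed

lemma eta_power_component: "eta_power d (graded_component H d x) = eta_power d x"
  by (rule linear_eq_component[OF linear_eta_power eta_power_homogeneous])

lemma convolution_eta_power: "convolution (eta_power i) (eta_power j) = eta_power (i + j)"
  by (induction i)
    (simp_all add: eta_power_simps convolution_counit_left linear_eta_power convolution_assoc linear_degree_one)

lemma foldr_convolution_eta_power: "foldr convolution (map eta_power D) \<epsilon> = eta_power (sum_list D)"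
  by (induction D) (simp_all add: eta_power_simps(1) convolution_eta_power)

lemma eta_basis:
  assumes "x \<in> B m"
  shows "eta H \<Delta> \<epsilon> B x = eta_power m x"
proof -
  \<comment> \<open>The sum defining \<open>eta\<close> runs over degrees with a nonzero component;
    for nonzero \<open>x\<close> this is \<open>m\<close> alone.\<close>
  have "x \<noteq> 0"
    using assms independent_B real_vector.dependent_zero by blast
  then have "{k. graded_component H k x \<noteq> 0} = {m}"
    using assms by (auto simp: graded_component_basis)
  then have "eta H \<Delta> \<epsilon> B x = eta_homogeneous H \<Delta> \<epsilon> B m x"
    using assms by (simp add: eta_def graded_component_basis)
  \<comment> \<open>\<lambda> takes the value 1 on \<open>B 1\<close>, so the plain sum of
    coefficients may be weighted by \<lambda> at every letter and read as a convolution.\<close>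
  also have "\<dots> = (\<Sum>cs\<in>listset (map B (replicate m 1)). coproduct_coeff \<Delta> \<epsilon> B x cs *
      prod_list (map2 (\<lambda>f x. f x) (replicate m degree_one) cs))"
  proof -
    have "prod_list (map2 (\<lambda>f x. f x) (replicate m degree_one) cs) = 1"
      if "length cs = m" "set cs \<subseteq> B 1" for cs
      using that by (induction cs arbitrary: m) (auto simp: degree_one_basis)
    then have 1: "prod_list (map2 (\<lambda>f x. f x) (replicate m degree_one) cs) = 1"
      if "cs \<in> listset (map B (replicate m 1))" for cs
      using that by (simp add: listset_replicate)
    have 2: "replicate m (B 1) = map B (replicate m 1)"
      by simp
    show ?thesis
      unfolding eta_homogeneous_def 2
      by (intro sum.cong) (simp_all only: tensor_coeff_coproduct_comp(1) 1 mult_1_right refl)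
  qed
  also have "\<dots> = foldr convolution (replicate m degree_one) \<epsilon> x"
    by (rule sum_coproduct_coeff_functionals)
      (simp add: list_all2_conv_all_nth linear_degree_one degree_one_component[unfolded One_nat_def])
  also have "\<dots> = eta_power m x"
    by (simp add: eta_power_def)
  finally show ?thesis .
qed

lemma prod_list_eta:
  "zs \<in> listset (map B D) \<Longrightarrow>
    prod_list (map2 (\<lambda>f x. f x) (map eta_power D) zs) = prod_list (map (eta H \<Delta> \<epsilon> B) zs)"
  by (induction D arbitrary: zs) (auto simp: set_Cons_def eta_basis)

text \<open>With one power of \<lambda> per part of \<open>D\<close>, the iterated convolution
  collapses to the power of total exponent. This normalises the breaking step.\<close>

lemma sum_coproduct_coeff_eta:
  assumes "x \<in> B (sum_list D)"
  shows "(\<Sum>zs\<in>listset (map B D). coproduct_coeff \<Delta> \<epsilon> B x zs * prod_list (map (eta H \<Delta> \<epsilon> B) zs)) =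
    eta H \<Delta> \<epsilon> B x"
proof -
  have "list_all2 (\<lambda>f d. linear f \<and> (\<forall>x. f (graded_component H d x) = f x)) (map eta_power D) D"
    by (simp add: list_all2_conv_all_nth linear_eta_power eta_power_component)
  from sum_coproduct_coeff_functionals[OF this, of x] show ?thesis
    using assms by (simp add: prod_list_eta foldr_convolution_eta_power eta_basis)
qed

section \<open>Products and the total joining weight\<close>

text \<open>By bilinearity both arguments may be homogeneous. A factor of degree 0 is a scalar by
  connectedness; if both degrees are positive, the product has degree at least 2 and both counits
  vanish, so each side is 0.\<close>

lemma degree_one_mult: "degree_one (a * b) = \<epsilon> a * degree_one b + degree_one a * \<epsilon> b"
proof (rule linear_grade_eqI[of "\<lambda>a. degree_one (a * b)"])
  show "linear (\<lambda>a. degree_one (a * b))"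
    using linear_degree_one by (simp add: linear_iff distrib_right)
  show "linear (\<lambda>a. \<epsilon> a * degree_one b + degree_one a * \<epsilon> b)"
    using linear_degree_one linear_counit by (simp add: linear_iff algebra_simps)
  fix i a assume a: "a \<in> H i"
  show "degree_one (a * b) = \<epsilon> a * degree_one b + degree_one a * \<epsilon> b"
  proof (rule linear_grade_eqI[of "\<lambda>b. degree_one (a * b)"])
    show "linear (\<lambda>b. degree_one (a * b))"
      using linear_degree_one by (simp add: linear_iff distrib_left)
    show "linear (\<lambda>b. \<epsilon> a * degree_one b + degree_one a * \<epsilon> b)"
      using linear_degree_one linear_counit by (simp add: linear_iff algebra_simps)
    fix j b assume b: "b \<in> H j"
    have scalar: "\<exists>c. z = c *\<^sub>R 1" if "z \<in> H 0" for z
      using that by (auto simp: connected real_vector.span_singleton)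
    have counit_scalar: "\<epsilon> (c *\<^sub>R 1) = c" for c
      using linear_scale[OF linear_counit, of c 1] by (simp add: counit_one)
    have degree_one_scalar: "degree_one (c *\<^sub>R 1) = 0" for c
    proof (rule degree_one_homogeneous[of _ 0])
      show "c *\<^sub>R 1 \<in> H 0"
        unfolding connected by (intro real_vector.span_scale real_vector.span_base) simp
    qed simp
    show "degree_one (a * b) = \<epsilon> a * degree_one b + degree_one a * \<epsilon> b"
    proof (cases "i = 0 \<or> j = 0")
      case True
      then show ?thesis
      proof
        assume "i = 0"
        then obtain c where "a = c *\<^sub>R 1"
          using a scalar by blast
        then show ?thesis
          using degree_one_scalar[of 1] by (simp add: counit_scalar linear_scale[OF linear_degree_one])
      next
        assume "j = 0"
        then obtain c where "b = c *\<^sub>R 1"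
          using b scalar by blast
        then show ?thesis
          using degree_one_scalar[of 1] by (simp add: counit_scalar linear_scale[OF linear_degree_one])
      qed
    next
      case False
      then have "degree_one (a * b) = 0"
        by (intro degree_one_homogeneous[OF mult_graded[OF a b]]) auto
      then show ?thesis
        using False a b by (simp add: counit_graded)
    qed
  qed
qed

text \<open>Convolving the rule for the \<open>k\<close>-th power with the derivation rule of
  \<lambda> yields two shifted sums, which Pascal's rule joins.\<close>

lemma eta_power_mult_Leibniz:
  "eta_power k (a * b) = (\<Sum>j\<le>k. real (k choose j) * (eta_power j a * eta_power (k - j) b))"
proof (induction k arbitrary: a b)
  case 0
  then show ?case by (simp add: eta_power_simps counit_mult)
next
  case (Suc k)
  \<comment> \<open>The Boolean \<open>p\<close> tells on which factor \<lambda> acts; the other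
    factor receives \<epsilon>.\<close>
  let ?f1 = "\<lambda>p. if p then degree_one else \<epsilon>" and ?f2 = "\<lambda>p. if p then \<epsilon> else degree_one"
  let ?F = "\<lambda>j. eta_power j a * eta_power (Suc k - j) b"
  have "eta_power (Suc k) (a * b) = (\<Sum>p\<in>UNIV. \<Sum>j\<le>k. real (k choose j) *
      (convolution (?f1 p) (eta_power j) a * convolution (?f2 p) (eta_power (k - j)) b))"
    unfolding eta_power_simps
    by (rule convolution_mult[where ?f1.0 = ?f1 and ?f2.0 = ?f2])
      (simp_all add: linear_degree_one linear_counit linear_eta_power Suc.IH UNIV_bool degree_one_mult)
  also have "\<dots> = (\<Sum>j\<le>k. real (k choose j) * (eta_power j a * eta_power (Suc (k - j)) b)) +
      (\<Sum>j\<le>k. real (k choose j) * (eta_power (Suc j) a * eta_power (k - j) b))"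
    by (simp add: UNIV_bool convolution_counit_left linear_eta_power eta_power_simps(2))
  also have "\<dots> = (\<Sum>j\<le>k. real (k choose j) * ?F j) + (\<Sum>j\<le>k. real (k choose j) * ?F (Suc j))"
    by (simp add: Suc_diff_le)
  \<comment> \<open>The added term has coefficient \<open>k choose Suc k\<close>, which is 0; it
    aligns the index ranges for Pascal's rule.\<close>
  also have "(\<Sum>j\<le>k. real (k choose j) * ?F j) = (\<Sum>j\<le>Suc k. real (k choose j) * ?F j)"
    by simp
  also have "\<dots> = ?F 0 + (\<Sum>j\<le>k. real (k choose Suc j) * ?F (Suc j))"
    by (subst sum.atMost_Suc_shift) simp
  also have "\<dots> + (\<Sum>j\<le>k. real (k choose j) * ?F (Suc j)) =
      ?F 0 + (\<Sum>j\<le>k. real (Suc k choose Suc j) * ?F (Suc j))"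
    by (simp add: sum.distrib algebra_simps)
  also have "\<dots> = (\<Sum>j\<le>Suc k. real (Suc k choose j) * ?F j)"
    by (subst sum.atMost_Suc_shift) simp
  finally show ?case .
qed

text \<open>The degree of \<open>a\<close> alone singles out the Leibniz term with index
  \<open>i\<close>.\<close>

lemma eta_power_mult:
  assumes "a \<in> H i"
  shows "eta_power (i + j) (a * b) = real ((i + j) choose i) * (eta_power i a * eta_power j b)"
proof -
  have "eta_power (i + j) (a * b) =
      (\<Sum>k\<le>i + j. if k = i then real ((i + j) choose i) * (eta_power i a * eta_power j b) else 0)"
    unfolding eta_power_mult_Leibniz using assms
    by (intro sum.cong) (auto simp: eta_power_homogeneous)
  then show ?thesis by simp
qed

lemma prod_list_in: "zs \<in> listset (map B D) \<Longrightarrow> prod_list zs \<in> H (sum_list D)"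
proof (induction D arbitrary: zs)
  case Nil
  then show ?case by (simp add: connected real_vector.span_base)
next
  case (Cons d D)
  then show ?case by (auto simp: set_Cons_def intro!: mult_graded[OF B_subset])
qed

lemma eta_power_prod_list:
  "zs \<in> listset (map B D) \<Longrightarrow>
    eta_power (sum_list D) (prod_list zs) = multinomial D * prod_list (map (eta H \<Delta> \<epsilon> B) zs)"
proof (induction D arbitrary: zs)
  case Nil
  then show ?case by (simp add: eta_power_simps counit_one multinomial_Nil)
next
  case (Cons d D)
  then show ?case
    by (auto simp: set_Cons_def multinomial_Cons eta_power_mult[OF B_subset] eta_basis)
qed

text \<open>The product of the letters is expanded in its degree and \<eta> is applied. This
  normalises the joining step.\<close>

lemma sum_mult_coeff_eta:
  assumes "zs \<in> listset (map B D)"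
  shows "(\<Sum>y\<in>B (sum_list D). mult_coeff B zs y * eta H \<Delta> \<epsilon> B y) =
    multinomial D * prod_list (map (eta H \<Delta> \<epsilon> B) zs)"
  using homogeneous_expansion[OF linear_eta_power prod_list_in[OF assms], of "sum_list D"]
  by (simp add: mult_coeff_def eta_basis eta_power_prod_list[OF assms])

lemma tensor_mult_coproduct_comp:
  "tensor_mult (coproduct_comp H \<Delta> \<epsilon> D x) =
    (\<Sum>zs\<in>listset (map B D). coproduct_coeff \<Delta> \<epsilon> B x zs *\<^sub>R prod_list zs)"
  by (simp add: coproduct_comp_expansion[OF linear_tensor_mult] tensor_mult_tens)

lemma tensor_mult_coproduct_comp_in: "tensor_mult (coproduct_comp H \<Delta> \<epsilon> D x) \<in> H (sum_list D)"
  unfolding tensor_mult_coproduct_comp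
  by (intro subspace_sum[OF subspace_grade] subspace_scale[OF subspace_grade] prod_list_in)

lemma coord_mult_coproduct_comp:
  "coord y (tensor_mult (coproduct_comp H \<Delta> \<epsilon> D x)) =
    (\<Sum>zs\<in>listset (map B D). coproduct_coeff \<Delta> \<epsilon> B x zs * mult_coeff B zs y)"
  by (simp add: tensor_mult_coproduct_comp linear_sum[OF linear_coord] linear_scale[OF linear_coord] mult_coeff_def)

lemma coord_inject:
  assumes "\<And>z. coord z v = coord z w"
  shows "v = w"
proof -
  have "representation U v = representation U w"
    using assms by blast
  then show ?thesis
    using real_vector.sum_nonzero_representation_eq[OF independent_U, of v]
      real_vector.sum_nonzero_representation_eq[OF independent_U, of w]
    unfolding span_U by (metis UNIV_I)
qed

end

section \<open>The Markov chain\<close>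

lemma prob_weights_finite_iff:
  "finite A \<Longrightarrow> prob_weights A w \<longleftrightarrow> (\<forall>a\<in>A. w a \<ge> 0) \<and> sum w A = 1"
  by (auto simp: prob_weights_def has_sum_finite_iff)

lemma
  assumes "finite A" "prob_weights A w"
  shows pmf_embed_prob_weights: "pmf (embed_pmf (\<lambda>a. if a \<in> A then w a else 0)) a = (if a \<in> A then w a else 0)"
    and set_embed_prob_weights: "set_pmf (embed_pmf (\<lambda>a. if a \<in> A then w a else 0)) \<subseteq> A"
proof -
  let ?w = "\<lambda>a. if a \<in> A then w a else 0"
  have w: "\<And>a. a \<in> A \<Longrightarrow> w a \<ge> 0" "sum w A = 1"
    using assms by (auto simp: prob_weights_finite_iff)
  have "(\<integral>\<^sup>+a. ennreal (?w a) \<partial>count_space UNIV) = (\<Sum>a\<in>A. ennreal (?w a))"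
    using assms(1) by (intro nn_integral_count_space') auto
  also have "\<dots> = 1"
    using w by (simp add: sum_ennreal)
  finally have "(\<integral>\<^sup>+a. ennreal (?w a) \<partial>count_space UNIV) = 1" .
  then show *: "pmf (embed_pmf ?w) a = ?w a" for a
    using w by (intro pmf_embed_pmf) auto
  show "set_pmf (embed_pmf ?w) \<subseteq> A"
    using * by (auto simp: set_pmf_eq split: if_splits)
qed

text \<open>Boundedness gives integrability, hence absolute summability, and the integral becomes
  the unordered sum in which the series for the descent operator is expressed.\<close>

lemma has_sum_pmf_expectation:
  fixes f :: "'b \<Rightarrow> real"
  assumes "set_pmf P \<subseteq> A" and bounded: "\<And>a. \<bar>f a\<bar> \<le> c"
  shows "((\<lambda>a. pmf P a * f a) has_sum measure_pmf.expectation P f) A"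
proof -
  have "integrable (measure_pmf P) f"
    using bounded by (intro measure_pmf.integrable_const_bound[where B = c]) auto
  then have "integrable (count_space UNIV) (\<lambda>a. pmf P a * f a)"
    unfolding measure_pmf_eq_density by (simp add: integrable_density)
  note summable = this[folded abs_summable_on_def]
  have "(\<lambda>a. pmf P a * f a) summable_on UNIV"
    using summable by (simp add: abs_summable_equivalent[symmetric] abs_summable_summable)
  moreover have "infsum (\<lambda>a. pmf P a * f a) UNIV = infsetsum (\<lambda>a. pmf P a * f a) UNIV"
    by (rule infsetsum_infsum[OF summable, symmetric])
  moreover have "infsetsum (\<lambda>a. pmf P a * f a) UNIV = measure_pmf.expectation P f"
    unfolding infsetsum_def measure_pmf_eq_density by (simp add: integral_density)
  ultimately have "((\<lambda>a. pmf P a * f a) has_sum measure_pmf.expectation P f) UNIV"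
    using has_sum_infsum by metis
  \<comment> \<open>Terms off the support of \<open>P\<close> vanish, so the sum over all values is
    already the sum over \<open>A\<close>.\<close>
  then show ?thesis
    by (rule has_sum_cong_neutral[THEN iffD1, rotated -1])
      (use assms(1) in \<open>auto simp: set_pmf_iff\<close>)
qed

lemma has_sum_sum_finite:
  fixes f :: "'i \<Rightarrow> 'b \<Rightarrow> real"
  assumes "finite I" "\<And>i. i \<in> I \<Longrightarrow> (f i has_sum s i) A"
  shows "((\<lambda>a. \<Sum>i\<in>I. f i a) has_sum (\<Sum>i\<in>I. s i)) A"
  using assms by (induction I rule: finite_induct) (simp_all add: has_sum_0 has_sum_add)

locale hopf_markov_chain = based_hopf_algebra H \<Delta> \<epsilon> S B
  for H :: "nat \<Rightarrow> 'a::real_algebra_1 set" and \<Delta> \<epsilon> S B +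
  fixes n :: nat and P :: "nat list pmf"
  assumes support: "set_pmf P \<subseteq> weak_compositions n"
    and state_space: "state_space_basis H \<Delta> \<epsilon> B P"
begin

abbreviation \<eta> :: "'a \<Rightarrow> real" where "\<eta> \<equiv> eta H \<Delta> \<epsilon> B"

lemma
  assumes D: "D \<in> set_pmf P"
  shows sum_list_support: "sum_list D = n"
    and mult_coeff_nonneg: "zs \<in> listset (map B D) \<Longrightarrow> y \<in> B n \<Longrightarrow> mult_coeff B zs y \<ge> 0"
    and coproduct_coeff_nonneg: "x \<in> B n \<Longrightarrow> zs \<in> listset (map B D) \<Longrightarrow> coproduct_coeff \<Delta> \<epsilon> B x zs \<ge> 0"
proof -
  show n: "sum_list D = n"
    using D support by (auto simp: weak_compositions_def)
  have "state_space_basis_comp H \<Delta> \<epsilon> B D"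
    using D state_space by (auto simp: state_space_basis_def pmf_positive_iff)
  then show "zs \<in> listset (map B D) \<Longrightarrow> y \<in> B n \<Longrightarrow> mult_coeff B zs y \<ge> 0"
    "x \<in> B n \<Longrightarrow> zs \<in> listset (map B D) \<Longrightarrow> coproduct_coeff \<Delta> \<epsilon> B x zs \<ge> 0"
    unfolding state_space_basis_comp_def n
    by (blast, metis tensor_coeff_coproduct_comp(1))
qed

text \<open>Positivity of \<eta> is asserted only together with a weak-composition of positive
  probability; the support of \<open>P\<close> is nonempty and supplies one.\<close>

lemma eta_pos: "x \<in> U \<Longrightarrow> \<eta> x > 0"
proof -
  obtain D where "D \<in> set_pmf P"
    using set_pmf_not_empty[of P] by blast
  then have "state_space_basis_comp H \<Delta> \<epsilon> B D"
    using state_space by (auto simp: state_space_basis_def pmf_positive_iff)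
  then show "x \<in> U \<Longrightarrow> \<eta> x > 0"
    unfolding state_space_basis_comp_def by blast
qed

lemma eta_pos_B: "x \<in> B m \<Longrightarrow> \<eta> x > 0"
  by (rule eta_pos) blast

lemma prod_list_eta_pos: "zs \<in> listset (map B D) \<Longrightarrow> prod_list (map \<eta> zs) > 0"
  by (induction D arbitrary: zs) (auto simp: set_Cons_def intro!: mult_pos_pos eta_pos_B)

lemma prob_weights_break_prob:
  assumes x: "x \<in> B n" and D: "D \<in> set_pmf P"
  shows "prob_weights (listset (map B D)) (break_prob H \<Delta> \<epsilon> B x)"
proof -
  have "(\<Sum>zs\<in>listset (map B D). break_prob H \<Delta> \<epsilon> B x zs) =
      1 / \<eta> x * (\<Sum>zs\<in>listset (map B D). coproduct_coeff \<Delta> \<epsilon> B x zs * prod_list (map \<eta> zs))"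
    by (simp add: break_prob_def sum_distrib_left mult.assoc sum_divide_distrib)
  also have "\<dots> = 1"
    using sum_coproduct_coeff_eta[of x D] sum_list_support[OF D] x eta_pos_B[OF x] by simp
  finally show ?thesis
    using coproduct_coeff_nonneg[OF D x] prod_list_eta_pos[of _ D] eta_pos_B[OF x]
    by (auto simp: prob_weights_finite_iff[OF finite_listset_B] break_prob_def less_imp_le)
qed

lemma prob_weights_join_prob:
  assumes D: "D \<in> set_pmf P" and zs: "zs \<in> listset (map B D)"
  shows "prob_weights (B n) (join_prob H \<Delta> \<epsilon> B D zs)"
proof -
  have pos: "multinomial D * prod_list (map \<eta> zs) > 0"
    by (intro mult_pos_pos multinomial_pos prod_list_eta_pos[OF zs])
  have "(\<Sum>y\<in>B n. join_prob H \<Delta> \<epsilon> B D zs y) =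
      inverse (multinomial D * prod_list (map \<eta> zs)) * (\<Sum>y\<in>B n. mult_coeff B zs y * \<eta> y)"
    by (simp add: join_prob_def sum_distrib_left mult.assoc)
  also have "\<dots> = 1"
    using sum_mult_coeff_eta[OF zs] sum_list_support[OF D] pos
    by (simp add: left_inverse[OF less_imp_neq[OF pos, THEN not_sym]] del: inverse_mult_distrib)
  finally show ?thesis
    using mult_coeff_nonneg[OF D zs] pos eta_pos_B[of _ n]
    unfolding prob_weights_finite_iff[OF finite_B] join_prob_def
    by (auto intro!: mult_nonneg_nonneg simp: less_imp_le simp del: inverse_mult_distrib)
qed

section \<open>The three-step process and the descent operator\<close>

text \<open>Breaking and joining for a fixed \<open>D\<close>; the full process is the mixture of
  these laws over \<open>P\<close>.\<close>

definition step_law :: "'a \<Rightarrow> nat list \<Rightarrow> 'a pmf" where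
  "step_law x D =
     bind_pmf (embed_pmf (\<lambda>zs. if zs \<in> listset (map B D) then break_prob H \<Delta> \<epsilon> B x zs else 0)) (\<lambda>zs.
     embed_pmf (\<lambda>y. if y \<in> B n then join_prob H \<Delta> \<epsilon> B D zs y else 0))"

lemma three_step_law_eq: "three_step_law H \<Delta> \<epsilon> B n P x = bind_pmf P (step_law x)"
  by (simp add: three_step_law_def step_law_def[abs_def])

text \<open>The weights \<eta> of the pieces cancel between breaking and joining. What remains sums
  to the coefficient of \<open>y\<close> in the product of the projected coproduct.\<close>

lemma
  assumes x: "x \<in> B n" and D: "D \<in> set_pmf P"
  shows set_step_law: "set_pmf (step_law x D) \<subseteq> B n"
    and pmf_step_law: "y \<in> B n \<Longrightarrow> pmf (step_law x D) y =
      \<eta> y / \<eta> x * (coord y (tensor_mult (coproduct_comp H \<Delta> \<epsilon> D x)) / multinomial D)"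
proof -
  note break = prob_weights_break_prob[OF x D] and join = prob_weights_join_prob[OF D]
  show "set_pmf (step_law x D) \<subseteq> B n"
    unfolding step_law_def
    using set_embed_prob_weights[OF finite_listset_B break] set_embed_prob_weights[OF finite_B join]
    by auto
  show "pmf (step_law x D) y =
      \<eta> y / \<eta> x * (coord y (tensor_mult (coproduct_comp H \<Delta> \<epsilon> D x)) / multinomial D)" if y: "y \<in> B n"
  proof -
    have "pmf (step_law x D) y =
        (\<Sum>zs\<in>listset (map B D). break_prob H \<Delta> \<epsilon> B x zs * join_prob H \<Delta> \<epsilon> B D zs y)"
      unfolding step_law_def pmf_bind
      using set_embed_prob_weights[OF finite_listset_B break] y
      by (subst integral_measure_pmf[OF finite_listset_B[of D]])
        (auto simp: pmf_embed_prob_weights[OF finite_listset_B break]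
          pmf_embed_prob_weights[OF finite_B join] intro!: sum.cong)
    also have "\<dots> = (\<Sum>zs\<in>listset (map B D).
        \<eta> y / \<eta> x * (coproduct_coeff \<Delta> \<epsilon> B x zs * mult_coeff B zs y / multinomial D))"
    proof (rule sum.cong[OF refl])
      fix zs assume "zs \<in> listset (map B D)"
      then have "prod_list (map \<eta> zs) \<noteq> 0" "multinomial D \<noteq> 0" "\<eta> x \<noteq> 0"
        using prod_list_eta_pos multinomial_pos[of D] eta_pos_B[OF x] by fastforce+
      then show "break_prob H \<Delta> \<epsilon> B x zs * join_prob H \<Delta> \<epsilon> B D zs y =
          \<eta> y / \<eta> x * (coproduct_coeff \<Delta> \<epsilon> B x zs * mult_coeff B zs y / multinomial D)"
        by (simp add: break_prob_def join_prob_def field_simps)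
    qed
    also have "\<dots> = \<eta> y / \<eta> x * (coord y (tensor_mult (coproduct_comp H \<Delta> \<epsilon> D x)) / multinomial D)"
      by (simp add: coord_mult_coproduct_comp sum_distrib_left sum_divide_distrib)
    finally show ?thesis .
  qed
qed

text \<open>The convergence needed for the descent operator: averages of probabilities, bounded by
  1.\<close>

lemma has_sum_three_step_law:
  "((\<lambda>D. pmf P D * pmf (step_law x D) y) has_sum pmf (three_step_law H \<Delta> \<epsilon> B n P x) y) (weak_compositions n)"
  unfolding three_step_law_eq pmf_bind
  by (rule has_sum_pmf_expectation[OF support, where c = 1]) (simp add: pmf_le_1)

text \<open>The limit is read off from the law of the process, so existence follows from
  \<open>has_sum_three_step_law\<close>. It is unique because the coordinate functionals separate
  vectors.\<close>

lemma descent_operator_eq: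
  assumes x: "x \<in> B n"
  shows "descent_operator H \<Delta> \<epsilon> n P x =
    (\<Sum>y\<in>B n. (\<eta> x / \<eta> y * pmf (three_step_law H \<Delta> \<epsilon> B n P x) y) *\<^sub>R y)" (is "_ = ?v")
  unfolding descent_operator_def
proof (rule the_equality)
  show *: "\<forall>\<phi> :: 'a \<Rightarrow> real. linear \<phi> \<longrightarrow>
     ((\<lambda>D. pmf P D / multinomial D * \<phi> (tensor_mult (coproduct_comp H \<Delta> \<epsilon> D x))) has_sum \<phi> ?v)
       (weak_compositions n)"
  proof (intro allI impI)
    fix \<phi> :: "'a \<Rightarrow> real" assume \<phi>: "linear \<phi>"
    \<comment> \<open>On the support, \<open>pmf_step_law\<close> trades each coordinate for a
      rescaled transition probability; elsewhere both sides are 0. The series thus becomes a finite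
      combination of convergent ones.\<close>
    have expansion: "pmf P D / multinomial D * \<phi> (tensor_mult (coproduct_comp H \<Delta> \<epsilon> D x)) =
        (\<Sum>y\<in>B n. \<eta> x / \<eta> y * \<phi> y * (pmf P D * pmf (step_law x D) y))" for D
    proof (cases "D \<in> set_pmf P")
      case D: True
      have "\<phi> (tensor_mult (coproduct_comp H \<Delta> \<epsilon> D x)) =
          (\<Sum>y\<in>B n. coord y (tensor_mult (coproduct_comp H \<Delta> \<epsilon> D x)) *\<^sub>R \<phi> y)"
        using homogeneous_expansion[OF \<phi> tensor_mult_coproduct_comp_in[of D x]] sum_list_support[OF D]
        by simp
      then have "pmf P D / multinomial D * \<phi> (tensor_mult (coproduct_comp H \<Delta> \<epsilon> D x)) =
          (\<Sum>y\<in>B n. pmf P D / multinomial D * (coord y (tensor_mult (coproduct_comp H \<Delta> \<epsilon> D x)) * \<phi> y))"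
        by (simp add: sum_distrib_left)
      also have "\<dots> = (\<Sum>y\<in>B n. \<eta> x / \<eta> y * \<phi> y * (pmf P D * pmf (step_law x D) y))"
      proof (rule sum.cong[OF refl])
        fix y assume y: "y \<in> B n"
        then show "pmf P D / multinomial D * (coord y (tensor_mult (coproduct_comp H \<Delta> \<epsilon> D x)) * \<phi> y) =
            \<eta> x / \<eta> y * \<phi> y * (pmf P D * pmf (step_law x D) y)"
          using eta_pos_B[OF x] eta_pos_B[OF y] by (simp add: pmf_step_law[OF x D y])
      qed
      finally show ?thesis .
    qed (simp add: set_pmf_iff)
    have "\<phi> ?v = (\<Sum>y\<in>B n. \<eta> x / \<eta> y * \<phi> y * pmf (three_step_law H \<Delta> \<epsilon> B n P x) y)"
      by (simp add: linear_sum[OF \<phi>] linear_scale[OF \<phi>] mult_ac)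
    then show "((\<lambda>D. pmf P D / multinomial D * \<phi> (tensor_mult (coproduct_comp H \<Delta> \<epsilon> D x))) has_sum \<phi> ?v)
        (weak_compositions n)"
      unfolding expansion by (simp only:) (intro has_sum_sum_finite finite_B has_sum_cmult_right has_sum_three_step_law)
  qed
  fix v assume v: "\<forall>\<phi> :: 'a \<Rightarrow> real. linear \<phi> \<longrightarrow>
     ((\<lambda>D. pmf P D / multinomial D * \<phi> (tensor_mult (coproduct_comp H \<Delta> \<epsilon> D x))) has_sum \<phi> v)
       (weak_compositions n)"
  show "v = ?v"
  proof (rule coord_inject)
    show "coord z v = coord z ?v" for z
      by (rule has_sum_unique[OF v[rule_format, OF linear_coord] *[rule_format, OF linear_coord]])
  qed
qed

lemma K_hat_eq:
  assumes x: "x \<in> B n" and y: "y \<in> B n"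
  shows "K_hat H \<Delta> \<epsilon> B n P x y = pmf (three_step_law H \<Delta> \<epsilon> B n P x) y"
proof -
  let ?p = "\<lambda>z. \<eta> x / \<eta> z * pmf (three_step_law H \<Delta> \<epsilon> B n P x) z"
  have "coord y z = of_bool (y = z)" if "z \<in> B n" for z
    using that by (intro coord_basis) blast
  then have "coord y (descent_operator H \<Delta> \<epsilon> n P x) = (\<Sum>z\<in>B n. if z = y then ?p y else 0)"
    by (auto simp: descent_operator_eq[OF x] linear_sum[OF linear_coord] linear_scale[OF linear_coord]
        intro!: sum.cong)
  then show ?thesis
    using y eta_pos_B[OF x] eta_pos_B[OF y] by (simp add: K_hat_def finite_B)
qed

text \<open>Row \<open>x\<close> is the mass function of a law supported in the finite set
  \<open>B n\<close>, so non-negativity and total mass 1 are inherited.\<close>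

lemma prob_weights_K_hat:
  assumes "x \<in> B n"
  shows "prob_weights (B n) (K_hat H \<Delta> \<epsilon> B n P x)"
proof -
  have "set_pmf (three_step_law H \<Delta> \<epsilon> B n P x) \<subseteq> B n"
    using set_step_law[OF assms] by (auto simp: three_step_law_eq)
  from sum_pmf_eq_1[OF finite_B this] show ?thesis
    using assms by (simp add: prob_weights_finite_iff finite_B K_hat_eq)
qed

end

theorem theorem3p4:
  fixes H :: "nat \<Rightarrow> 'a::real_algebra_1 set"
    and \<Delta> :: "'a \<Rightarrow> 'a tensor" and \<epsilon> :: "'a \<Rightarrow> real" and S :: "'a \<Rightarrow> 'a"
    and B :: "nat \<Rightarrow> 'a set" and n :: nat and P :: "nat list pmf"
  assumes "graded_connected_hopf_algebra H \<Delta> \<epsilon> S"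
    and "\<And>m. \<exists>F. finite F \<and> span F = H m"
    and "set_pmf P \<subseteq> weak_compositions n"
    and "state_space_basis H \<Delta> \<epsilon> B P"
  shows "(\<forall>x\<in>B n. prob_weights (B n) (K_hat H \<Delta> \<epsilon> B n P x)) \<and>
    (\<forall>x\<in>B n. \<forall>D\<in>set_pmf P. prob_weights (listset (map B D)) (break_prob H \<Delta> \<epsilon> B x)) \<and>
    (\<forall>D\<in>set_pmf P. \<forall>zs\<in>listset (map B D). prob_weights (B n) (join_prob H \<Delta> \<epsilon> B D zs)) \<and>
    (\<forall>x\<in>B n. \<forall>y\<in>B n. pmf (three_step_law H \<Delta> \<epsilon> B n P x) y = K_hat H \<Delta> \<epsilon> B n P x y)"
proof -
  interpret graded_connected_hopf_algebra H \<Delta> \<epsilon> S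
    by fact
  interpret hopf_markov_chain H \<Delta> \<epsilon> S B n P
    by unfold_locales (use assms(2-4) in \<open>auto simp: state_space_basis_def\<close>)
  show ?thesis
    using prob_weights_K_hat prob_weights_break_prob prob_weights_join_prob K_hat_eq by simp
qed

end
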